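(* Let $m\ge n$ and let the $m\times n$ quaternion matrix $\mathbf A$ have quaternion singular value decomposition $$\mathbf A=\mathbf U\Sigma\mathbf V^*=\mathbf U\begin{bmatrix}\Sigma_1&0\\0&\Sigma_2\end{bmatrix}\begin{bmatrix}\mathbf V_1^*\\ \mathbf V_2^*\end{bmatrix},\qquad \Sigma_1\in\mathbb R^{k\times k},\quad \mathbf V_1\in\mathbb Q^{n\times k},$$ where $\Sigma=\mathrm{diag}(\sigma_1,\ldots,\sigma_n)$ with $\sigma_1\ge\sigma_2\ge\cdots\ge\sigma_n\ge 0$ and $k\ge 1$ is the target rank. Let $p\ge 1$ be the oversampling parameter, $q=0$, $\ell=k+p\le n$, and let $\mathbf Y_0=\mathbf A\mathbf\Omega$, where $\mathbf\Omega$ is an $n\times\ell$ quaternion random test matrix; assume $\mathbf\Omega_1=\mathbf V_1^*\mathbf\Omega$ has full row rank. Then the expected approximation error for the rank-$(k+p)$ matrix $\widehat{\mathbf A}^{(0)}_{k+p}$ produced by the power-scheme-free randomized QSVD algorithm satisfies $$\mathsf E\,\|\widehat{\mathbf A}^{(0)}_{k+p}-\mathbf A\|_F\le\left(1+\frac{4k}{4p+2}\right)^{1/2}\Big(\sum_{j>k}\sigma_j^2\Big)^{1/2}.$$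
   Context: $\mathbb Q$ denotes the real quaternions and $\mathbb Q^{m\times n}$ the $m\times n$ quaternion matrices; $\mathbf M^*$ is the conjugate transpose. Every $\mathbf A\in\mathbb Q^{m\times n}$ has a QSVD $\mathbf A=\mathbf U\Sigma\mathbf V^*$ with $\mathbf U\in\mathbb Q^{m\times m}$, $\mathbf V\in\mathbb Q^{n\times n}$ quaternion unitary and $\Sigma\in\mathbb R^{m\times n}$ diagonal with nonnegative nonincreasing diagonal entries (the singular values); for $m\ge n$ the notation $\Sigma=\mathrm{diag}(\sigma_1,\dots,\sigma_n)$ means this $m\times n$ matrix. $\|\mathbf M\|_F=(\sum_{i,j}|\mathbf m_{ij}|^2)^{1/2}$ is the Frobenius norm, with $|\cdot|$ the quaternion modulus. Quaternion random test matrix: $\mathbf\Omega=\Omega_0+\Omega_1\mathbf i+\Omega_2\mathbf j+\Omega_3\mathbf k\in\mathbb Q^{n\times\ell}$, where all entries of the four real $n\times \ell$ component matrices are independent $N(0,1)$ random variables. (These real component matrices are not to be confused with the quaternion matrix $\mathbf\Omega_1=\mathbf V_1^*\mathbf\Omega\in\mathbb Q^{k\times\ell}$.) Randomized QSVD algorithm (power scheme parameter $q$): form $\mathbf Y_q=(\mathbf A\mathbf A^* )^q\mathbf A\mathbf\Omega$ (for $q=0$, $\mathbf Y_0=\mathbf A\mathbf\Omega$); compute by quaternion QR decomposition of $\mathbf Y_q$ an $m\times\ell$ matrix $\mathbf Q$ with orthonormal columns whose range contains the column range of $\mathbf Y_q$ (an orthonormal basis for that range). The rank-$(k+p)$ approximation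 is $\widehat{\mathbf A}^{(q)}_{k+p}=\mathbf Q\mathbf Q^*\mathbf A$, so $\|\widehat{\mathbf A}^{(q)}_{k+p}-\mathbf A\|=\|(I_m-\mathbf Q\mathbf Q^* )\mathbf A\|$. $\mathsf E$ is expectation with respect to $\mathbf\Omega$. *)

theory Defs
  imports "HOL-Probability.Probability" "Jordan_Normal_Form.Matrix"
begin

section \<open>The real quaternions\<close>

datatype quat = Quat (qre: real) (qim1: real) (qim2: real) (qim3: real)

lemma quat_eqI:
  "qre x = qre y \<Longrightarrow> qim1 x = qim1 y \<Longrightarrow> qim2 x = qim2 y \<Longrightarrow> qim3 x = qim3 y \<Longrightarrow> x = y"
  by (rule quat.expand) simp

lemma quat_eq_iff:
  "x = y \<longleftrightarrow> qre x = qre y \<and> qim1 x = qim1 y \<and> qim2 x = qim2 y \<and> qim3 x = qim3 y"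
  by (auto intro: quat_eqI)

instantiation quat :: ring_1
begin

definition "0 = Quat 0 0 0 0"
definition "1 = Quat 1 0 0 0"
definition "x + y = Quat (qre x + qre y) (qim1 x + qim1 y) (qim2 x + qim2 y) (qim3 x + qim3 y)"
definition "x - y = Quat (qre x - qre y) (qim1 x - qim1 y) (qim2 x - qim2 y) (qim3 x - qim3 y)"
definition "- x = Quat (- qre x) (- qim1 x) (- qim2 x) (- qim3 x)"
definition "x * y = Quat
   (qre x * qre y - qim1 x * qim1 y - qim2 x * qim2 y - qim3 x * qim3 y)
   (qre x * qim1 y + qim1 x * qre y + qim2 x * qim3 y - qim3 x * qim2 y)
   (qre x * qim2 y - qim1 x * qim3 y + qim2 x * qre y + qim3 x * qim1 y)
   (qre x * qim3 y + qim1 x * qim2 y - qim2 x * qim1 y + qim3 x * qre y)"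

instance
  by standard
    (simp_all add: quat_eq_iff zero_quat_def one_quat_def plus_quat_def minus_quat_def
      uminus_quat_def times_quat_def algebra_simps)

end

lemma zero_quat_sel [simp]: "qre 0 = 0" "qim1 0 = 0" "qim2 0 = 0" "qim3 0 = 0"
  and one_quat_sel [simp]: "qre 1 = 1" "qim1 1 = 0" "qim2 1 = 0" "qim3 1 = 0"
  and plus_quat_sel [simp]: "qre (x + y) = qre x + qre y" "qim1 (x + y) = qim1 x + qim1 y"
    "qim2 (x + y) = qim2 x + qim2 y" "qim3 (x + y) = qim3 x + qim3 y"
  and minus_quat_sel [simp]: "qre (x - y) = qre x - qre y" "qim1 (x - y) = qim1 x - qim1 y"
    "qim2 (x - y) = qim2 x - qim2 y" "qim3 (x - y) = qim3 x - qim3 y"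
  and uminus_quat_sel [simp]: "qre (- x) = - qre x" "qim1 (- x) = - qim1 x"
    "qim2 (- x) = - qim2 x" "qim3 (- x) = - qim3 x"
  and times_quat_sel [simp]:
    "qre (x * y) = qre x * qre y - qim1 x * qim1 y - qim2 x * qim2 y - qim3 x * qim3 y"
    "qim1 (x * y) = qre x * qim1 y + qim1 x * qre y + qim2 x * qim3 y - qim3 x * qim2 y"
    "qim2 (x * y) = qre x * qim2 y - qim1 x * qim3 y + qim2 x * qre y + qim3 x * qim1 y"
    "qim3 (x * y) = qre x * qim3 y + qim1 x * qim2 y - qim2 x * qim1 y + qim3 x * qre y"
  by (simp_all add: zero_quat_def one_quat_def plus_quat_def minus_quat_def uminus_quat_def
      times_quat_def)

instantiation quat :: real_vector
begin

definition "scaleR r x = Quat (r * qre x) (r * qim1 x) (r * qim2 x) (r * qim3 x)"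

instance
  by standard (simp_all add: quat_eq_iff scaleR_quat_def algebra_simps)

end

lemma scaleR_quat_sel [simp]: "qre (r *\<^sub>R x) = r * qre x" "qim1 (r *\<^sub>R x) = r * qim1 x"
    "qim2 (r *\<^sub>R x) = r * qim2 x" "qim3 (r *\<^sub>R x) = r * qim3 x"
  by (simp_all add: scaleR_quat_def)

instantiation quat :: real_inner
begin

definition "inner x y = qre x * qre y + qim1 x * qim1 y + qim2 x * qim2 y + qim3 x * qim3 y"
definition "norm x = sqrt ((qre x)\<^sup>2 + (qim1 x)\<^sup>2 + (qim2 x)\<^sup>2 + (qim3 x)\<^sup>2)"
definition sgn_quat_def: "sgn x = x /\<^sub>R norm (x :: quat)"
definition dist_quat_def: "dist x y = norm (x - y :: quat)"
definition uniformity_quat_def [code del]: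
  "(uniformity :: (quat \<times> quat) filter) = (INF e\<in>{0 <..}. principal {(x, y). dist x y < e})"
definition open_quat_def [code del]:
  "open (U :: quat set) \<longleftrightarrow> (\<forall>x\<in>U. eventually (\<lambda>(x', y). x' = x \<longrightarrow> y \<in> U) uniformity)"

instance
proof
  fix x y :: quat
  show "0 \<le> inner x x"
    by (simp add: inner_quat_def)
  show "inner x x = 0 \<longleftrightarrow> x = 0"
    by (simp add: inner_quat_def quat_eq_iff add_nonneg_eq_0_iff)
  show "norm x = sqrt (inner x x)"
    by (simp add: norm_quat_def inner_quat_def power2_eq_square)
qed (auto simp: sgn_quat_def dist_quat_def open_quat_def uniformity_quat_def
    inner_quat_def quat_eq_iff algebra_simps)

end

definition qcnj :: "quat \<Rightarrow> quat" where
  "qcnj x = Quat (qre x) (- qim1 x) (- qim2 x) (- qim3 x)"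

lemma qcnj_sel [simp]: "qre (qcnj x) = qre x" "qim1 (qcnj x) = - qim1 x"
    "qim2 (qcnj x) = - qim2 x" "qim3 (qcnj x) = - qim3 x"
  by (simp_all add: qcnj_def)

lemma norm_quat_sq: "(norm x)\<^sup>2 = (qre x)\<^sup>2 + (qim1 x)\<^sup>2 + (qim2 x)\<^sup>2 + (qim3 x)\<^sup>2"
  by (simp add: norm_quat_def)

lemma qcnj_mult_self: "qcnj x * x = (norm x)\<^sup>2 *\<^sub>R 1" "x * qcnj x = (norm x)\<^sup>2 *\<^sub>R 1"
  unfolding norm_quat_sq by (simp_all add: quat_eq_iff power2_eq_square)

instantiation quat :: real_normed_div_algebra
begin

definition "inverse x = qcnj x /\<^sub>R (norm x)\<^sup>2"
definition "x div (y :: quat) = x * inverse y"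

instance
proof
  fix x y :: quat and r :: real
  show rl: "(r *\<^sub>R x) * y = r *\<^sub>R (x * y)" and rr: "x * (r *\<^sub>R y) = r *\<^sub>R (x * y)" for r x and y :: quat
    by (simp_all add: quat_eq_iff algebra_simps)
  show "x div y = x * inverse y"
    by (rule divide_quat_def)
  show "inverse (0 :: quat) = 0"
    by (simp add: inverse_quat_def)
  show "inverse x * x = 1" "x * inverse x = 1" if "x \<noteq> 0"
    using that by (simp_all add: inverse_quat_def rl rr qcnj_mult_self)
  show "norm (x * y) = norm x * norm y"
    unfolding norm_quat_def real_sqrt_mult [symmetric]
    by (rule arg_cong [where f = sqrt]) (simp add: power2_eq_square algebra_simps)
qed

end

section \<open>Quaternion matrices\<close>

text \<open>The library's adjoint is based on a multiplicative conjugation, whereas \<^const>\<open>qcnj\<close>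
  reverses products.\<close>

definition qadjoint :: "quat mat \<Rightarrow> quat mat" where
  "qadjoint A = mat (dim_col A) (dim_row A) (\<lambda>(i, j). qcnj (A $$ (j, i)))"

definition frobenius_norm :: "quat mat \<Rightarrow> real" where
  "frobenius_norm A = sqrt (\<Sum>i<dim_row A. \<Sum>j<dim_col A. (norm (A $$ (i, j)))\<^sup>2)"

definition qunitary :: "nat \<Rightarrow> quat mat \<Rightarrow> bool" where
  "qunitary n U \<longleftrightarrow> U \<in> carrier_mat n n \<and> qadjoint U * U = 1\<^sub>m n \<and> U * qadjoint U = 1\<^sub>m n"

definition rect_diag :: "nat \<Rightarrow> nat \<Rightarrow> (nat \<Rightarrow> real) \<Rightarrow> quat mat" where
  "rect_diag m n \<sigma> = mat m n (\<lambda>(i, j). if i = j then of_real (\<sigma> i) else 0)"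

text \<open>Indices start at \<open>0\<close>, so \<open>\<sigma> j\<close> is the \<open>(j+1)\<close>-st largest singular value.\<close>

definition is_qsvd :: "nat \<Rightarrow> nat \<Rightarrow> quat mat \<Rightarrow> quat mat \<Rightarrow> (nat \<Rightarrow> real) \<Rightarrow> quat mat \<Rightarrow> bool" where
  "is_qsvd m n A U \<sigma> V \<longleftrightarrow>
     qunitary m U \<and> qunitary n V \<and>
     (\<forall>i < min m n. 0 \<le> \<sigma> i) \<and>
     (\<forall>i j. i \<le> j \<and> j < min m n \<longrightarrow> \<sigma> j \<le> \<sigma> i) \<and>
     A = U * rect_diag m n \<sigma> * qadjoint V"

definition first_cols :: "nat \<Rightarrow> 'a mat \<Rightarrow> 'a mat" where
  "first_cols k A = mat (dim_row A) k (\<lambda>(i, j). A $$ (i, j))"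

text \<open>Scalars act on rows from the left, so a linear combination of the rows of \<open>A\<close> is
  \<open>x * A\<close> with \<open>x\<close> a row matrix; on columns they act from the right, which gives \<open>A *\<^sub>v x\<close>.\<close>

definition full_row_rank :: "'a :: semiring_0 mat \<Rightarrow> bool" where
  "full_row_rank A \<longleftrightarrow>
     (\<forall>x \<in> carrier_mat 1 (dim_row A). x * A = 0\<^sub>m 1 (dim_col A) \<longrightarrow> x = 0\<^sub>m 1 (dim_row A))"

definition col_range :: "'a :: semiring_0 mat \<Rightarrow> 'a vec set" where
  "col_range A = {A *\<^sub>v x | x. x \<in> carrier_vec (dim_col A)}"

section \<open>The randomized QSVD algorithm\<close>

text \<open>The \<open>Q\<close> factor is only specified, not computed: if \<open>Y\<close> does not have full column rank,
  different QR decompositions may complete an orthonormal basis of its range differently.\<close>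

definition is_qr_basis :: "quat mat \<Rightarrow> quat mat \<Rightarrow> bool" where
  "is_qr_basis Y Q \<longleftrightarrow>
     Q \<in> carrier_mat (dim_row Y) (dim_col Y) \<and>
     qadjoint Q * Q = 1\<^sub>m (dim_col Y) \<and>
     col_range Y \<subseteq> col_range Q"

definition rqsvd_approx :: "quat mat \<Rightarrow> quat mat \<Rightarrow> quat mat" where
  "rqsvd_approx A Q = Q * qadjoint Q * A"

definition quat_comp :: "nat \<Rightarrow> quat \<Rightarrow> real" where
  "quat_comp c x = [qre x, qim1 x, qim2 x, qim3 x] ! c"

definition quat_random_test_matrix ::
    "'w measure \<Rightarrow> nat \<Rightarrow> nat \<Rightarrow> ('w \<Rightarrow> quat mat) \<Rightarrow> bool" where
  "quat_random_test_matrix M n l \<Omega> \<longleftrightarrow>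
     prob_space M \<and>
     (\<forall>\<omega>\<in>space M. \<Omega> \<omega> \<in> carrier_mat n l) \<and>
     prob_space.indep_vars M (\<lambda>_. borel) (\<lambda>(c, i, j) \<omega>. quat_comp c (\<Omega> \<omega> $$ (i, j)))
       ({..<4} \<times> {..<n} \<times> {..<l}) \<and>
     (\<forall>c<4. \<forall>i<n. \<forall>j<l.
        distributed M lborel (\<lambda>\<omega>. quat_comp c (\<Omega> \<omega> $$ (i, j))) std_normal_density)"

end

theory Submission
  imports Defs
begin

text \<open>
  Write \<open>G = V\<^sup>* \<Omega>\<close>, with first \<open>k\<close> rows \<open>G\<^sub>1\<close> and remaining rows \<open>G\<^sub>2\<close>. The residual
  \<open>C = (I - Q Q\<^sup>*) U \<Sigma>\<close> satisfies \<open>C G = 0\<close>. If \<open>R\<close> is a right inverse of \<open>G\<^sub>1\<close>, the first \<open>k\<close>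
  columns of \<open>C\<close> are therefore \<open>- C\<^sub>2 G\<^sub>2 R\<close>, and as \<open>I - Q Q\<^sup>*\<close> is a contraction the squared error is
  at most \<open>\<parallel>\<Sigma>\<^sub>2\<parallel>\<^sup>2 + \<parallel>\<Sigma>\<^sub>2 G\<^sub>2 R\<parallel>\<^sup>2\<close>. By unitary invariance \<open>G\<close> is again Gaussian. Choose as \<open>i\<close>-th
  column of \<open>R\<close> the vector \<open>y\<^sup>* / \<parallel>y\<parallel>\<^sup>2\<close>, where \<open>y\<close> is the component of row \<open>i\<close> orthogonal to the
  other rows of \<open>G\<^sub>1\<close>. Then \<open>\<parallel>\<Sigma>\<^sub>2 G\<^sub>2 R\<parallel>\<^sup>2\<close> has mean \<open>4 \<parallel>\<Sigma>\<^sub>2\<parallel>\<^sup>2\<close> times the sum of the means of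
  \<open>1 / \<parallel>y\<parallel>\<^sup>2\<close>. Here \<open>y = P x\<close> with \<open>x\<close> Gaussian and \<open>P\<close> a real orthogonal projection of trace at
  least \<open>4 (p + 1)\<close>, and Stein's identity for the field \<open>P x / (\<parallel>P x\<parallel>\<^sup>2 + \<epsilon>)\<close> bounds the mean of
  \<open>1 / \<parallel>P x\<parallel>\<^sup>2\<close> by \<open>1 / (4 p + 2)\<close>. Jensen's inequality concludes.
\<close>

section \<open>Gaussian product measures\<close>

definition gauss :: "'i set \<Rightarrow> ('i \<Rightarrow> real) measure" where
  "gauss I = (\<Pi>\<^sub>M i\<in>I. std_normal_distribution)"

lemma prob_space_std_normal: "prob_space std_normal_distribution"
  by (rule prob_space_normal_density) simp

interpretation std_normal_prod: product_sigma_finite "\<lambda>_ :: 'i. std_normal_distribution"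
  by (intro product_sigma_finite.intro prob_space_std_normal prob_space_imp_sigma_finite)

interpretation lborel_prod: product_sigma_finite "\<lambda>_ :: 'i. lborel :: real measure"
  by (intro product_sigma_finite.intro) (rule lborel.sigma_finite_measure_axioms)

lemma prob_space_gauss: "prob_space (gauss I)"
  unfolding gauss_def by (intro prob_space_PiM prob_space_std_normal)

lemma sets_gauss [measurable_cong]: "sets (gauss I) = sets (\<Pi>\<^sub>M i\<in>I. borel)"
  unfolding gauss_def by (intro sets_PiM_cong) auto

lemma space_gauss [simp]: "space (gauss I) = (\<Pi>\<^sub>E i\<in>I. UNIV)"
  unfolding gauss_def by (simp add: space_PiM)

text \<open>A finite product measure is determined by its values on boxes; on a box the density and
  the indicator both factor over the coordinates, and so does the integral.\<close>

lemma gauss_eq_density: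
  assumes "finite I"
  shows "gauss I = density (\<Pi>\<^sub>M i\<in>I. lborel) (\<lambda>x. \<Prod>i\<in>I. ennreal (std_normal_density (x i)))"
  unfolding gauss_def
proof (rule sym, rule std_normal_prod.PiM_eqI[OF assms])
  show "sets (density (\<Pi>\<^sub>M i\<in>I. lborel) (\<lambda>x. \<Prod>i\<in>I. ennreal (std_normal_density (x i))))
        = sets (\<Pi>\<^sub>M i\<in>I. std_normal_distribution)"
    by (auto intro!: sets_PiM_cong)
next
  fix B :: "'a \<Rightarrow> real set"
  assume "\<And>i. i \<in> I \<Longrightarrow> B i \<in> sets std_normal_distribution"
  hence B [measurable]: "\<And>i. i \<in> I \<Longrightarrow> B i \<in> sets borel" by simp
  have PB: "Pi\<^sub>E I B \<in> sets (\<Pi>\<^sub>M i\<in>I. lborel)"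
    using assms B by (intro sets_PiM_I_finite) auto
  have "emeasure (density (\<Pi>\<^sub>M i\<in>I. lborel) (\<lambda>x. \<Prod>i\<in>I. ennreal (std_normal_density (x i)))) (Pi\<^sub>E I B)
      = (\<integral>\<^sup>+x. (\<Prod>i\<in>I. ennreal (std_normal_density (x i))) * indicator (Pi\<^sub>E I B) x \<partial>(\<Pi>\<^sub>M i\<in>I. lborel))"
    by (rule emeasure_density[OF _ PB]) measurable
  also have "\<dots> = (\<integral>\<^sup>+x. (\<Prod>i\<in>I. ennreal (std_normal_density (x i)) * indicator (B i) (x i)) \<partial>(\<Pi>\<^sub>M i\<in>I. lborel))"
  proof (rule nn_integral_cong)
    fix x assume "x \<in> space (\<Pi>\<^sub>M i\<in>I. lborel :: real measure)"
    hence "indicator (Pi\<^sub>E I B) x = (\<Prod>i\<in>I. indicator (B i) (x i) :: ennreal)"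
      using assms by (auto simp: indicator_def space_PiM PiE_iff prod_zero_iff)
    thus "(\<Prod>i\<in>I. ennreal (std_normal_density (x i))) * indicator (Pi\<^sub>E I B) x
       = (\<Prod>i\<in>I. ennreal (std_normal_density (x i)) * indicator (B i) (x i))"
      by (simp add: prod.distrib)
  qed
  also have "\<dots> = (\<Prod>i\<in>I. \<integral>\<^sup>+y. ennreal (std_normal_density y) * indicator (B i) y \<partial>lborel)"
    by (rule lborel_prod.product_nn_integral_prod[OF assms]) measurable
  also have "\<dots> = (\<Prod>i\<in>I. emeasure std_normal_distribution (B i))"
    by (intro prod.cong refl emeasure_density[symmetric]) auto
  finally show "emeasure (density (\<Pi>\<^sub>M i\<in>I. lborel) (\<lambda>x. \<Prod>i\<in>I. ennreal (std_normal_density (x i)))) (Pi\<^sub>E I B)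
      = (\<Prod>i\<in>I. emeasure std_normal_distribution (B i))" .
qed

section \<open>Translation invariance and isometry invariance\<close>

lemma distr_PiM_lborel_translate:
  fixes y :: "'i \<Rightarrow> real"
  assumes "finite I"
  shows "distr (\<Pi>\<^sub>M i\<in>I. lborel) (\<Pi>\<^sub>M i\<in>I. lborel) (\<lambda>x. \<lambda>i\<in>I. x i + y i) = (\<Pi>\<^sub>M i\<in>I. lborel)"
proof (rule lborel_prod.PiM_eqI[OF assms])
  fix B :: "'i \<Rightarrow> real set"
  assume B: "\<And>i. i \<in> I \<Longrightarrow> B i \<in> sets lborel"
  have PB: "Pi\<^sub>E I B \<in> sets (\<Pi>\<^sub>M i\<in>I. lborel)"
    using assms B by (intro sets_PiM_I_finite) auto
  have meas: "(\<lambda>x. \<lambda>i\<in>I. x i + y i) \<in> measurable (\<Pi>\<^sub>M i\<in>I. lborel) (\<Pi>\<^sub>M i\<in>I. lborel :: real measure)"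
    by (intro measurable_restrict) measurable
  have "(\<lambda>x. \<lambda>i\<in>I. x i + y i) -` Pi\<^sub>E I B \<inter> space (\<Pi>\<^sub>M i\<in>I. lborel)
      = Pi\<^sub>E I (\<lambda>i. (\<lambda>t. y i + t) -` B i)"
    by (auto simp: space_PiM PiE_iff add.commute)
  hence "emeasure (distr (\<Pi>\<^sub>M i\<in>I. lborel) (\<Pi>\<^sub>M i\<in>I. lborel) (\<lambda>x. \<lambda>i\<in>I. x i + y i)) (Pi\<^sub>E I B)
     = emeasure (\<Pi>\<^sub>M i\<in>I. lborel) (Pi\<^sub>E I (\<lambda>i. (\<lambda>t. y i + t) -` B i))"
    by (simp add: emeasure_distr[OF meas PB])
  also have "\<dots> = (\<Prod>i\<in>I. emeasure lborel ((\<lambda>t. y i + t) -` B i))"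
  proof (rule lborel_prod.emeasure_PiM[OF assms])
    fix i assume "i \<in> I"
    thus "(\<lambda>t. y i + t) -` B i \<in> sets lborel"
      using measurable_sets[of "\<lambda>t. y i + t" borel borel "B i"] B[of i] by auto
  qed
  also have "\<dots> = (\<Prod>i\<in>I. emeasure lborel (B i))"
  proof (rule prod.cong[OF refl])
    fix i assume "i \<in> I"
    hence "emeasure (distr lborel borel ((+) (y i))) (B i) = emeasure lborel ((+) (y i) -` B i \<inter> space lborel)"
      using B[of i] by (intro emeasure_distr) auto
    thus "emeasure lborel ((\<lambda>t. y i + t) -` B i) = emeasure lborel (B i)"
      by (simp add: lborel_distr_plus)
  qed
  finally show "emeasure (distr (\<Pi>\<^sub>M i\<in>I. lborel) (\<Pi>\<^sub>M i\<in>I. lborel) (\<lambda>x. \<lambda>i\<in>I. x i + y i)) (Pi\<^sub>E I B)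
     = (\<Prod>i\<in>I. emeasure lborel (B i))" .
qed simp

lemma nn_integral_PiM_lborel_translate:
  assumes "finite I" and f: "f \<in> borel_measurable (\<Pi>\<^sub>M i\<in>I. lborel :: real measure)"
  shows "(\<integral>\<^sup>+x. f (\<lambda>i\<in>I. x i + y i) \<partial>(\<Pi>\<^sub>M i\<in>I. lborel)) = (\<integral>\<^sup>+x. f x \<partial>(\<Pi>\<^sub>M i\<in>I. lborel))"
proof -
  have "(\<lambda>x. \<lambda>i\<in>I. x i + y i) \<in> measurable (\<Pi>\<^sub>M i\<in>I. lborel) (\<Pi>\<^sub>M i\<in>I. lborel :: real measure)"
    by (intro measurable_restrict) measurable
  hence "(\<integral>\<^sup>+x. f x \<partial>distr (\<Pi>\<^sub>M i\<in>I. lborel) (\<Pi>\<^sub>M i\<in>I. lborel) (\<lambda>x. \<lambda>i\<in>I. x i + y i))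
      = (\<integral>\<^sup>+x. f (\<lambda>i\<in>I. x i + y i) \<partial>(\<Pi>\<^sub>M i\<in>I. lborel))"
    using f by (intro nn_integral_distr) auto
  thus ?thesis
    by (simp add: distr_PiM_lborel_translate[OF assms(1)])
qed

text \<open>The integral of the Gaussian density is inserted as a second variable; translating either
  variable then trades the isometry for a translation.\<close>

lemma nn_integral_gauss_isometry:
  fixes T :: "('i \<Rightarrow> real) \<Rightarrow> 'i \<Rightarrow> real"
  assumes fin: "finite I"
    and T: "T \<in> measurable (\<Pi>\<^sub>M i\<in>I. borel) (\<Pi>\<^sub>M i\<in>I. borel)"
    and add: "\<And>x y i. x \<in> (\<Pi>\<^sub>E i\<in>I. UNIV) \<Longrightarrow> y \<in> (\<Pi>\<^sub>E i\<in>I. UNIV) \<Longrightarrow> i \<in> I \<Longrightarrow>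
          T (\<lambda>i\<in>I. x i + y i) i = T x i + T y i"
    and iso: "\<And>x. x \<in> (\<Pi>\<^sub>E i\<in>I. UNIV) \<Longrightarrow> (\<Sum>i\<in>I. (T x i)\<^sup>2) = (\<Sum>i\<in>I. (x i)\<^sup>2)"
    and surj: "\<And>y. y \<in> (\<Pi>\<^sub>E i\<in>I. UNIV) \<Longrightarrow> \<exists>x\<in>(\<Pi>\<^sub>E i\<in>I. UNIV). T x = y"
    and f: "f \<in> borel_measurable (\<Pi>\<^sub>M i\<in>I. borel)"
  shows "(\<integral>\<^sup>+x. f (T x) \<partial>gauss I) = (\<integral>\<^sup>+x. f x \<partial>gauss I)"
proof -
  let ?L = "\<Pi>\<^sub>M i\<in>I. lborel :: real measure"
  define \<phi> where "\<phi> x = (\<Prod>i\<in>I. ennreal (std_normal_density (x i)))" for x :: "'i \<Rightarrow> real"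
  have seq: "sets ?L = sets (\<Pi>\<^sub>M i\<in>I. borel)"
    by (intro sets_PiM_cong) auto
  have spL: "space ?L = (\<Pi>\<^sub>E i\<in>I. UNIV)" by (simp add: space_PiM)
  have T' [measurable]: "T \<in> measurable ?L ?L"
    using T measurable_cong_sets[OF seq seq] by simp
  have f' [measurable]: "f \<in> borel_measurable ?L"
    using f measurable_cong_sets[OF seq refl] by auto
  have \<phi> [measurable]: "\<phi> \<in> borel_measurable ?L"
    unfolding \<phi>_def by measurable
  interpret L: finite_product_sigma_finite "\<lambda>_. lborel :: real measure" I
    by standard (rule fin)
  interpret LL: pair_sigma_finite ?L ?L
    by (intro pair_sigma_finite.intro L.sigma_finite_measure_axioms)
  \<comment> \<open>The density depends on \<open>x\<close> only through its squared norm, so it is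
    even and takes the same value at \<open>x\<close> and at \<open>T x\<close>.\<close>
  have \<phi>_eq: "\<phi> x = ennreal ((1 / sqrt (2 * pi)) ^ card I * exp (- (\<Sum>i\<in>I. (x i)\<^sup>2) / 2))" for x
    unfolding \<phi>_def std_normal_density_def
    by (subst prod_ennreal)
      (auto simp: prod.distrib exp_sum[OF fin, symmetric] sum_negf sum_divide_distrib power_divide power_one_over prod_dividef)
  have \<phi>_T: "\<phi> (T x) = \<phi> x" if "x \<in> space ?L" for x
    using iso that by (simp add: \<phi>_eq spL)
  have \<phi>_1: "(\<integral>\<^sup>+x. \<phi> x \<partial>?L) = 1"
    using prob_space.emeasure_space_1[OF prob_space_gauss[of I]] \<phi>
    by (simp add: gauss_eq_density[OF fin] \<phi>_def[symmetric] emeasure_density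
        del: space_gauss cong: nn_integral_cong)
  \<comment> \<open>Since the density is unchanged by \<open>T\<close>, it is enough that Lebesgue
    measure is.\<close>
  have inv: "(\<integral>\<^sup>+x. g (T x) \<partial>?L) = (\<integral>\<^sup>+x. g x \<partial>?L)" if g [measurable]: "g \<in> borel_measurable ?L" for g
  proof -
    have [measurable]: "(\<lambda>x. T (fst x) i) \<in> borel_measurable (?L \<Otimes>\<^sub>M ?L)" if "i \<in> I" for i
      using measurable_compose[OF measurable_compose[OF measurable_fst T']
          measurable_component_singleton[OF that]] by simp
    have [measurable]: "(\<lambda>(x, y). \<lambda>i\<in>I. y i - T x i) \<in> measurable (?L \<Otimes>\<^sub>M ?L) ?L"
      unfolding case_prod_unfold by (rule measurable_restrict) measurable
    have "(\<integral>\<^sup>+x. g (T x) \<partial>?L) = (\<integral>\<^sup>+x. g (T x) * (\<integral>\<^sup>+y. \<phi> y \<partial>?L) \<partial>?L)"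
      by (simp add: \<phi>_1)
    also have "\<dots> = (\<integral>\<^sup>+x. g (T x) * (\<integral>\<^sup>+y. \<phi> (\<lambda>i\<in>I. y i - T x i) \<partial>?L) \<partial>?L)"
      using nn_integral_PiM_lborel_translate[OF fin \<phi>, of "\<lambda>i. - T x i" for x] by simp
    also have "\<dots> = (\<integral>\<^sup>+x. (\<integral>\<^sup>+y. g (T x) * \<phi> (\<lambda>i\<in>I. y i - T x i) \<partial>?L) \<partial>?L)"
      by (intro nn_integral_cong nn_integral_cmult[symmetric]) measurable
    also have "\<dots> = (\<integral>\<^sup>+y. (\<integral>\<^sup>+x. g (T x) * \<phi> (\<lambda>i\<in>I. y i - T x i) \<partial>?L) \<partial>?L)"
      by (rule LL.Fubini'[symmetric]) measurable
    also have "\<dots> = (\<integral>\<^sup>+y. (\<integral>\<^sup>+x. g (\<lambda>i\<in>I. T x i + y i) * \<phi> x \<partial>?L) \<partial>?L)"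
    proof (rule nn_integral_cong)
      fix y assume y: "y \<in> space ?L"
      then obtain z where z: "z \<in> (\<Pi>\<^sub>E i\<in>I. UNIV)" "T z = y"
        using surj spL by auto
      \<comment> \<open>As \<open>T z = y\<close>, translating \<open>x\<close> by \<open>z\<close>
        turns \<open>T x\<close> into \<open>T x + y\<close> by additivity, and the argument of
        \<open>\<phi>\<close> into \<open>- T x\<close>.\<close>
      have "(\<integral>\<^sup>+x. g (T x) * \<phi> (\<lambda>i\<in>I. y i - T x i) \<partial>?L)
          = (\<integral>\<^sup>+x. g (T (\<lambda>i\<in>I. x i + z i)) * \<phi> (\<lambda>i\<in>I. y i - T (\<lambda>i\<in>I. x i + z i) i) \<partial>?L)"
        using y by (intro nn_integral_PiM_lborel_translate[OF fin, symmetric]) measurable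
      also have "\<dots> = (\<integral>\<^sup>+x. g (\<lambda>i\<in>I. T x i + y i) * \<phi> x \<partial>?L)"
      proof (rule nn_integral_cong)
        fix x assume x: "x \<in> space ?L"
        have Tsp: "T v \<in> (\<Pi>\<^sub>E i\<in>I. UNIV)" if "v \<in> space ?L" for v
          using measurable_space[OF T' that] spL by simp
        have 1: "T (\<lambda>i\<in>I. x i + z i) = (\<lambda>i\<in>I. T x i + y i)"
        proof (rule extensionalityI[of _ I])
          show "T (\<lambda>i\<in>I. x i + z i) \<in> extensional I"
            using Tsp[of "\<lambda>i\<in>I. x i + z i"] spL by (auto simp: PiE_def)
        qed (use add x z spL in auto)
        have "\<phi> (\<lambda>i\<in>I. y i - (\<lambda>i\<in>I. T x i + y i) i) = \<phi> (T x)"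
          unfolding \<phi>_eq by simp
        thus "g (T (\<lambda>i\<in>I. x i + z i)) * \<phi> (\<lambda>i\<in>I. y i - T (\<lambda>i\<in>I. x i + z i) i)
            = g (\<lambda>i\<in>I. T x i + y i) * \<phi> x"
          using \<phi>_T[OF x] 1 by simp
      qed
      finally show "(\<integral>\<^sup>+x. g (T x) * \<phi> (\<lambda>i\<in>I. y i - T x i) \<partial>?L) = (\<integral>\<^sup>+x. g (\<lambda>i\<in>I. T x i + y i) * \<phi> x \<partial>?L)" .
    qed
    also have "\<dots> = (\<integral>\<^sup>+x. (\<integral>\<^sup>+y. g (\<lambda>i\<in>I. y i + T x i) * \<phi> x \<partial>?L) \<partial>?L)"
      by (subst LL.Fubini') (simp_all add: add.commute)
    also have "\<dots> = (\<integral>\<^sup>+x. (\<integral>\<^sup>+y. g (\<lambda>i\<in>I. y i + T x i) \<partial>?L) * \<phi> x \<partial>?L)"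
      by (intro nn_integral_cong nn_integral_multc) measurable
    also have "\<dots> = (\<integral>\<^sup>+x. (\<integral>\<^sup>+y. g y \<partial>?L) * \<phi> x \<partial>?L)"
      by (simp add: nn_integral_PiM_lborel_translate[OF fin g])
    also have "\<dots> = (\<integral>\<^sup>+y. g y \<partial>?L)"
      by (subst nn_integral_cmult) (auto simp: \<phi>_1)
    finally show ?thesis .
  qed
  have "(\<integral>\<^sup>+x. f (T x) \<partial>gauss I) = (\<integral>\<^sup>+x. \<phi> x * f (T x) \<partial>?L)"
    unfolding gauss_eq_density[OF fin] \<phi>_def[symmetric] by (subst nn_integral_density) auto
  also have "\<dots> = (\<integral>\<^sup>+x. \<phi> (T x) * f (T x) \<partial>?L)"
    by (intro nn_integral_cong) (simp add: \<phi>_T)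
  also have "\<dots> = (\<integral>\<^sup>+x. \<phi> x * f x \<partial>?L)"
    by (rule inv) measurable
  also have "\<dots> = (\<integral>\<^sup>+x. f x \<partial>gauss I)"
    unfolding gauss_eq_density[OF fin] \<phi>_def[symmetric] by (subst nn_integral_density) auto
  finally show ?thesis .
qed

section \<open>Stein's identity and inverse moments of projections\<close>

text \<open>Integration by parts: \<open>f x * std_normal_density x\<close> has derivative
  \<open>(f' x - x * f x) * std_normal_density x\<close> and tends to 0 at both ends because
  \<open>f\<close> is bounded. The bound \<open>B\<close> also makes both integrals converge, the
  first one by the finite first absolute moment.\<close>

lemma std_normal_stein:
  fixes f f' :: "real \<Rightarrow> real"
  assumes der: "\<And>x. (f has_real_derivative f' x) (at x)"
    and cont: "\<And>x. isCont f' x"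
    and f_le: "\<And>x. \<bar>f x\<bar> \<le> B" and f'_le: "\<And>x. \<bar>f' x\<bar> \<le> B"
  shows "(\<integral>x. x * f x \<partial>std_normal_distribution) = (\<integral>x. f' x \<partial>std_normal_distribution)"
proof -
  let ?\<phi> = "std_normal_density"
  have f_meas [measurable]: "f \<in> borel_measurable borel"
    by (intro borel_measurable_continuous_onI continuous_at_imp_continuous_on ballI DERIV_isCont[OF der])
  have f'_meas [measurable]: "f' \<in> borel_measurable borel"
    by (intro borel_measurable_continuous_onI continuous_at_imp_continuous_on ballI cont)
  have int1: "integrable lborel (\<lambda>x. ?\<phi> x * (x * f x))"
  proof (rule Bochner_Integration.integrable_bound)
    show "integrable lborel (\<lambda>x. B * (?\<phi> x * x ^ 1))"
      by (intro integrable_mult_right integrable_std_normal_moment)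
    have "?\<phi> x * (\<bar>x\<bar> * \<bar>f x\<bar>) \<le> \<bar>B\<bar> * (?\<phi> x * \<bar>x\<bar>)" for x
    proof -
      have "?\<phi> x * \<bar>x\<bar> * \<bar>f x\<bar> \<le> ?\<phi> x * \<bar>x\<bar> * \<bar>B\<bar>"
        using f_le[of x] by (intro mult_left_mono) auto
      thus ?thesis by (simp add: algebra_simps)
    qed
    thus "AE x in lborel. norm (?\<phi> x * (x * f x)) \<le> norm (B * (?\<phi> x * x ^ 1))"
      by (simp add: abs_mult)
  qed measurable
  have int2: "integrable lborel (\<lambda>x. ?\<phi> x * f' x)"
  proof (rule Bochner_Integration.integrable_bound)
    show "integrable lborel (\<lambda>x. B * (?\<phi> x * x ^ 0))"
      by (intro integrable_mult_right integrable_std_normal_moment)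
    have "?\<phi> x * \<bar>f' x\<bar> \<le> \<bar>B\<bar> * ?\<phi> x" for x
    proof -
      have "?\<phi> x * \<bar>f' x\<bar> \<le> ?\<phi> x * \<bar>B\<bar>"
        using f'_le[of x] by (intro mult_left_mono) auto
      thus ?thesis by (simp add: algebra_simps)
    qed
    thus "AE x in lborel. norm (?\<phi> x * f' x) \<le> norm (B * (?\<phi> x * x ^ 0))"
      by (simp add: abs_mult)
  qed measurable
  have \<phi>_der: "(?\<phi> has_real_derivative - x * ?\<phi> x) (at x)" for x
    unfolding std_normal_density_def
    by (auto intro!: derivative_eq_intros simp: field_simps)
  have int: "integrable lborel (\<lambda>x. ?\<phi> x * f' x - ?\<phi> x * (x * f x))"
    by (intro Bochner_Integration.integrable_diff int1 int2)
  have \<phi>_lim: "(?\<phi> \<longlongrightarrow> 0) at_top" "(?\<phi> \<longlongrightarrow> 0) at_bot"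
    unfolding std_normal_density_def by real_asymp+
  have lim: "((\<lambda>x. f x * ?\<phi> x) \<longlongrightarrow> 0) F" if "(?\<phi> \<longlongrightarrow> 0) F" for F
  proof (rule Lim_null_comparison)
    show "\<forall>\<^sub>F x in F. norm (f x * ?\<phi> x) \<le> \<bar>B\<bar> * ?\<phi> x"
      using f_le by (intro always_eventually allI) (auto simp: abs_mult intro!: mult_right_mono order_trans[OF f_le])
    show "((\<lambda>x. \<bar>B\<bar> * ?\<phi> x) \<longlongrightarrow> 0) F"
      using that by (auto intro: tendsto_eq_intros)
  qed
  have "(LBINT x=-\<infinity>..\<infinity>. ?\<phi> x * f' x - ?\<phi> x * (x * f x)) = 0 - 0"
  proof (rule interval_integral_FTC_integrable[where F = "\<lambda>x. f x * ?\<phi> x"])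
    show "((\<lambda>x. f x * ?\<phi> x) has_vector_derivative ?\<phi> x * f' x - ?\<phi> x * (x * f x)) (at x)" for x
      unfolding has_real_derivative_iff_has_vector_derivative[symmetric]
      by (rule derivative_eq_intros der \<phi>_der refl)+ (simp add: algebra_simps)
    show "isCont (\<lambda>x. ?\<phi> x * f' x - ?\<phi> x * (x * f x)) x" for x
      by (intro continuous_intros cont DERIV_isCont[OF der] DERIV_isCont[OF \<phi>_der])
    show "set_integrable lborel (einterval (- \<infinity>) \<infinity>) (\<lambda>x. ?\<phi> x * f' x - ?\<phi> x * (x * f x))"
      using int by (simp add: set_integrable_def)
    show "(((\<lambda>x. f x * ?\<phi> x) \<circ> real_of_ereal) \<longlongrightarrow> 0) (at_right (-\<infinity>))"
      using lim[OF \<phi>_lim(2)] by (simp only: ereal_tendsto_simps1)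
    show "(((\<lambda>x. f x * ?\<phi> x) \<circ> real_of_ereal) \<longlongrightarrow> 0) (at_left \<infinity>)"
      using lim[OF \<phi>_lim(1)] by (simp only: ereal_tendsto_simps1)
  qed simp
  hence "(\<integral>x. ?\<phi> x * f' x - ?\<phi> x * (x * f x) \<partial>lborel) = 0"
    by (simp add: interval_lebesgue_integral_def set_lebesgue_integral_def)
  hence "(\<integral>x. ?\<phi> x * f' x \<partial>lborel) = (\<integral>x. ?\<phi> x * (x * f x) \<partial>lborel)"
    using int1 int2 by simp
  thus ?thesis
    by (simp add: integral_density)
qed

lemma integrable_gauss_component:
  fixes h :: "real \<Rightarrow> real"
  assumes "i \<in> I" and "integrable std_normal_distribution h"
  shows "integrable (gauss I) (\<lambda>x. h (x i))"
proof -
  have d: "distr (gauss I) std_normal_distribution (\<lambda>x. x i) = std_normal_distribution"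
    unfolding gauss_def by (rule distr_PiM_component[OF prob_space_std_normal assms(1)])
  have m: "(\<lambda>x. x i) \<in> measurable (gauss I) std_normal_distribution"
    unfolding gauss_def by (rule measurable_component_singleton[OF assms(1)])
  show ?thesis
    using integrable_distr[OF m, of h] assms(2) d by simp
qed

lemma integrable_std_normal_id: "integrable std_normal_distribution (\<lambda>x. x)"
  using integrable_std_normal_moment[of 1] by (subst integrable_density) auto

lemma has_real_derivative_coordinate:
  fixes P :: "'i \<Rightarrow> 'i \<Rightarrow> real"
  assumes "finite J" "\<alpha> \<in> J"
  shows "((\<lambda>t. \<Sum>\<gamma>\<in>J. P \<beta> \<gamma> * (x(\<alpha> := t)) \<gamma>) has_real_derivative P \<beta> \<alpha>) (at t)"
proof -
  have "(\<lambda>t. \<Sum>\<gamma>\<in>J. P \<beta> \<gamma> * (x(\<alpha> := t)) \<gamma>)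
      = (\<lambda>t. P \<beta> \<alpha> * t + (\<Sum>\<gamma>\<in>J - {\<alpha>}. P \<beta> \<gamma> * x \<gamma>))"
    by (subst sum.remove[OF assms]) (auto intro!: sum.cong)
  thus ?thesis
    by (auto intro!: derivative_eq_intros)
qed

text \<open>Stein's identity, applied in every coordinate to the field \<open>P x / D x\<close> with
  \<open>N = |P x|^2\<close> and \<open>D = N + e\<close>, gives
  \<open>E (N / D) = E (tr P / D - 2 N / D^2)\<close>. The left side is at most 1, and
  \<open>N \<le> D\<close> bounds the right side below by \<open>(r - 2) E (1 / D)\<close>. The
  shift \<open>e\<close> keeps the field and its derivatives bounded.\<close>

lemma nn_integral_inverse_proj_regularized:
  fixes P :: "'i \<Rightarrow> 'i \<Rightarrow> real" and r e :: real
  assumes fin: "finite J"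
    and sym: "\<And>\<alpha> \<beta>. \<alpha> \<in> J \<Longrightarrow> \<beta> \<in> J \<Longrightarrow> P \<alpha> \<beta> = P \<beta> \<alpha>"
    and idem: "\<And>\<alpha> \<beta>. \<alpha> \<in> J \<Longrightarrow> \<beta> \<in> J \<Longrightarrow> (\<Sum>\<gamma>\<in>J. P \<alpha> \<gamma> * P \<gamma> \<beta>) = P \<alpha> \<beta>"
    and r: "r \<le> (\<Sum>\<alpha>\<in>J. P \<alpha> \<alpha>)" "2 < r" and e: "0 < e"
  shows "(\<integral>\<^sup>+x. ennreal (1 / ((\<Sum>\<alpha>\<in>J. (\<Sum>\<beta>\<in>J. P \<alpha> \<beta> * x \<beta>)\<^sup>2) + e)) \<partial>gauss J) \<le> ennreal (1 / (r - 2))"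
proof -
  define Q where "Q x \<alpha> = (\<Sum>\<beta>\<in>J. P \<alpha> \<beta> * x \<beta>)" for x \<alpha>
  define N where "N x = (\<Sum>\<alpha>\<in>J. (Q x \<alpha>)\<^sup>2)" for x
  define D where "D x = N x + e" for x
  define tr where "tr = (\<Sum>\<alpha>\<in>J. P \<alpha> \<alpha>)"
  define F where "F \<alpha> x = Q x \<alpha> / D x" for \<alpha> x
  define F' where "F' \<alpha> x = P \<alpha> \<alpha> / D x - 2 * (Q x \<alpha>)\<^sup>2 / (D x)\<^sup>2" for \<alpha> x
  interpret G: prob_space "gauss J" by (rule prob_space_gauss)
  have PQ: "(\<Sum>\<beta>\<in>J. P \<alpha> \<beta> * Q x \<beta>) = Q x \<alpha>" if "\<alpha> \<in> J" for x \<alpha>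
  proof -
    have "(\<Sum>\<beta>\<in>J. P \<alpha> \<beta> * Q x \<beta>) = (\<Sum>\<beta>\<in>J. \<Sum>\<gamma>\<in>J. P \<alpha> \<beta> * P \<beta> \<gamma> * x \<gamma>)"
      unfolding Q_def by (simp add: sum_distrib_left mult.assoc)
    also have "\<dots> = (\<Sum>\<gamma>\<in>J. (\<Sum>\<beta>\<in>J. P \<alpha> \<beta> * P \<beta> \<gamma>) * x \<gamma>)"
      by (subst sum.swap) (simp add: sum_distrib_right)
    also have "\<dots> = Q x \<alpha>"
      unfolding Q_def using idem that by (intro sum.cong) auto
    finally show ?thesis .
  qed
  \<comment> \<open>\<open>P\<close> is symmetric and idempotent, so the inner product of
    \<open>x\<close> with \<open>P x\<close> is the squared norm of \<open>P x\<close>.\<close>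
  have xQ: "(\<Sum>\<alpha>\<in>J. x \<alpha> * Q x \<alpha>) = N x" for x
  proof -
    have "N x = (\<Sum>\<alpha>\<in>J. \<Sum>\<beta>\<in>J. P \<alpha> \<beta> * x \<beta> * Q x \<alpha>)"
      unfolding N_def power2_eq_square by (subst (1) Q_def) (simp add: sum_distrib_right)
    also have "\<dots> = (\<Sum>\<beta>\<in>J. \<Sum>\<alpha>\<in>J. x \<beta> * (P \<beta> \<alpha> * Q x \<alpha>))"
      by (subst sum.swap) (use sym in \<open>auto intro!: sum.cong simp: algebra_simps\<close>)
    also have "\<dots> = (\<Sum>\<beta>\<in>J. x \<beta> * Q x \<beta>)"
      by (simp add: sum_distrib_left[symmetric] PQ)
    finally show ?thesis ..
  qed
  have N0: "0 \<le> N x" for x unfolding N_def by (intro sum_nonneg) auto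
  have D0: "0 < D x" "e \<le> D x" for x using N0[of x] e unfolding D_def by auto
  have QN: "(Q x \<alpha>)\<^sup>2 \<le> N x" if "\<alpha> \<in> J" for x \<alpha>
    unfolding N_def using that fin by (intro member_le_sum) auto
  \<comment> \<open>One bound for both \<open>F\<close> and \<open>F'\<close>, as the
    one-dimensional identity asks for: \<open>1 + 1 / e\<close> bounds \<open>F\<close> through
    \<open>|t| \<le> 1 + t^2\<close>, and the last two summands bound \<open>F'\<close>.\<close>
  define B where "B \<alpha> = 1 + 1 / e + \<bar>P \<alpha> \<alpha>\<bar> / e + 2 / e" for \<alpha>
  have inv_D: "1 / D x \<le> 1 / e" for x
    using D0[of x] e by (intro divide_left_mono) auto
  have Q2D: "(Q x \<alpha>)\<^sup>2 / (D x)\<^sup>2 \<le> 1 / e" if "\<alpha> \<in> J" for x \<alpha>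
  proof -
    have "(Q x \<alpha>)\<^sup>2 / (D x)\<^sup>2 \<le> D x / (D x)\<^sup>2"
      using QN[OF that, of x] e by (intro divide_right_mono) (auto simp: D_def)
    also have "\<dots> = 1 / D x" by (simp add: power2_eq_square)
    finally show ?thesis using inv_D[of x] by simp
  qed
  have F_le: "\<bar>F \<alpha> x\<bar> \<le> B \<alpha>" if "\<alpha> \<in> J" for \<alpha> x
  proof -
    have "\<bar>Q x \<alpha>\<bar> \<le> 1 + (Q x \<alpha>)\<^sup>2"
      using zero_le_power2[of "\<bar>Q x \<alpha>\<bar> - 1"] zero_le_power2[of "Q x \<alpha>"]
      by (simp add: power2_diff power2_abs del: zero_le_power2)
    also have "\<dots> \<le> 1 + N x" using QN[OF that] by simp
    also have "\<dots> \<le> (1 + 1 / e) * D x"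
      using N0[of x] e by (simp add: D_def field_simps)
    finally have "\<bar>F \<alpha> x\<bar> \<le> 1 + 1 / e"
      using D0[of x] by (simp add: F_def abs_divide divide_le_eq)
    moreover have "0 \<le> \<bar>P \<alpha> \<alpha>\<bar> / e" "0 \<le> 2 / e" using e by auto
    ultimately show ?thesis unfolding B_def by linarith
  qed
  have F'_le: "\<bar>F' \<alpha> x\<bar> \<le> B \<alpha>" if "\<alpha> \<in> J" for \<alpha> x
  proof -
    have "\<bar>F' \<alpha> x\<bar> \<le> \<bar>P \<alpha> \<alpha> / D x\<bar> + \<bar>2 * (Q x \<alpha>)\<^sup>2 / (D x)\<^sup>2\<bar>"
      unfolding F'_def by (rule abs_triangle_ineq4)
    also have "\<bar>P \<alpha> \<alpha> / D x\<bar> \<le> \<bar>P \<alpha> \<alpha>\<bar> / e"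
      using D0[of x] e by (auto simp: abs_divide intro!: divide_left_mono)
    also have "\<bar>2 * (Q x \<alpha>)\<^sup>2 / (D x)\<^sup>2\<bar> \<le> 2 / e"
      using Q2D[OF that, of x] by simp
    finally have "\<bar>F' \<alpha> x\<bar> \<le> \<bar>P \<alpha> \<alpha>\<bar> / e + 2 / e" by simp
    moreover have "0 \<le> 1 / e" using e by auto
    ultimately show ?thesis unfolding B_def by linarith
  qed
  have Q_meas [measurable]: "(\<lambda>x. Q x \<alpha>) \<in> borel_measurable (gauss J)" for \<alpha>
    unfolding Q_def by measurable
  have D_meas [measurable]: "D \<in> borel_measurable (gauss J)"
    unfolding D_def N_def by measurable
  have F_meas [measurable]: "F \<alpha> \<in> borel_measurable (gauss J)"
    and F'_meas [measurable]: "F' \<alpha> \<in> borel_measurable (gauss J)" for \<alpha>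
    unfolding F_def F'_def by measurable
  have intF: "integrable (gauss J) (\<lambda>x. x \<alpha> * F \<alpha> x)" if "\<alpha> \<in> J" for \<alpha>
  proof (rule Bochner_Integration.integrable_bound)
    show "integrable (gauss J) (\<lambda>x. B \<alpha> * x \<alpha>)"
      using that by (intro integrable_mult_right integrable_gauss_component integrable_std_normal_id)
    show "AE x in gauss J. norm (x \<alpha> * F \<alpha> x) \<le> norm (B \<alpha> * x \<alpha>)"
      using F_le[OF that] by (auto simp: abs_mult mult.commute intro!: mult_left_mono order_trans[OF F_le[OF that]])
  qed (use that in measurable)
  have intF': "integrable (gauss J) (F' \<alpha>)" if "\<alpha> \<in> J" for \<alpha>
    using F'_le[OF that] by (intro G.integrable_const_bound[of _ "B \<alpha>"]) auto
  have int1D: "integrable (gauss J) (\<lambda>x. 1 / D x)"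
    using inv_D D0 by (intro G.integrable_const_bound[of _ "1 / e"]) (auto simp: less_imp_le)
  have intN: "integrable (gauss J) (\<lambda>x. N x / D x)"
    using N0 D0 e by (intro G.integrable_const_bound[of _ 1]) (auto simp: divide_le_eq D_def N_def)
  \<comment> \<open>Fubini singles out coordinate \<open>\<alpha>\<close>; the one-dimensional
    identity then applies with all other coordinates frozen.\<close>
  have stein: "(\<integral>x. x \<alpha> * F \<alpha> x \<partial>gauss J) = (\<integral>x. F' \<alpha> x \<partial>gauss J)" if \<alpha>: "\<alpha> \<in> J" for \<alpha>
  proof -
    have J: "J = insert \<alpha> (J - {\<alpha>})" and fin': "finite (J - {\<alpha>})" "\<alpha> \<notin> J - {\<alpha>}"
      using \<alpha> fin by auto
    have ins: "(\<integral>x. g x \<partial>gauss J) = (\<integral>x. (\<integral>t. g (x(\<alpha> := t)) \<partial>std_normal_distribution) \<partial>gauss (J - {\<alpha>}))"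
      if "integrable (gauss J) g" for g :: "_ \<Rightarrow> real"
      using std_normal_prod.product_integral_insert[OF fin', of g] that J
      unfolding gauss_def by simp
    have dQ: "((\<lambda>t. Q (x(\<alpha> := t)) \<beta>) has_real_derivative P \<beta> \<alpha>) (at t)" for x \<beta> t
      unfolding Q_def by (rule has_real_derivative_coordinate[OF fin \<alpha>])
    \<comment> \<open>The gradient of \<open>|P x|^2\<close> is \<open>2 P (P x)\<close>, which
      idempotence reduces to \<open>2 P x\<close>.\<close>
    have dD: "((\<lambda>t. D (x(\<alpha> := t))) has_real_derivative 2 * Q (x(\<alpha> := t)) \<alpha>) (at t)" for x t
    proof -
      have "((\<lambda>t. D (x(\<alpha> := t))) has_real_derivative (\<Sum>\<beta>\<in>J. 2 * Q (x(\<alpha> := t)) \<beta> * P \<beta> \<alpha>)) (at t)"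
        unfolding D_def N_def by (auto intro!: derivative_eq_intros dQ simp: mult_ac)
      also have "(\<Sum>\<beta>\<in>J. 2 * Q (x(\<alpha> := t)) \<beta> * P \<beta> \<alpha>) = 2 * (\<Sum>\<beta>\<in>J. P \<alpha> \<beta> * Q (x(\<alpha> := t)) \<beta>)"
        unfolding sum_distrib_left using sym \<alpha> by (auto intro!: sum.cong)
      finally show ?thesis by (simp only: PQ[OF \<alpha>])
    qed
    have cQ: "isCont (\<lambda>t. Q (x(\<alpha> := t)) \<beta>) t" and cD: "isCont (\<lambda>t. D (x(\<alpha> := t))) t" for x t \<beta>
      using DERIV_isCont[OF dQ] DERIV_isCont[OF dD] by blast+
    have "(\<integral>t. t * F \<alpha> (x(\<alpha> := t)) \<partial>std_normal_distribution) = (\<integral>t. F' \<alpha> (x(\<alpha> := t)) \<partial>std_normal_distribution)" for x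
    proof (rule std_normal_stein)
      show "((\<lambda>t. F \<alpha> (x(\<alpha> := t))) has_real_derivative F' \<alpha> (x(\<alpha> := t))) (at t)" for t
      proof -
        have quot: "(b * d - a * (2 * a)) / (d * d) = b / d - 2 * a\<^sup>2 / d\<^sup>2" if "d \<noteq> 0" for a b d :: real
          using that by (simp add: field_simps power2_eq_square)
        have nz: "D (x(\<alpha> := t)) \<noteq> 0" using D0(1) less_irrefl by metis
        show ?thesis
          unfolding F_def F'_def
          by (rule DERIV_cong[OF DERIV_divide[OF dQ dD nz]])
            (rule quot[OF nz])
      qed
      show "isCont (\<lambda>t. F' \<alpha> (x(\<alpha> := t))) t" for t
        unfolding F'_def using D0(1)[of "x(\<alpha> := t)"] by (intro continuous_intros cQ cD) auto
    qed (use F_le[OF \<alpha>] F'_le[OF \<alpha>] in auto)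
    thus ?thesis
      by (simp add: ins[OF intF[OF \<alpha>]] ins[OF intF'[OF \<alpha>]])
  qed
  have "(r - 2) * (\<integral>x. 1 / D x \<partial>gauss J) = (\<integral>x. (r - 2) * (1 / D x) \<partial>gauss J)"
    by (rule integral_mult_right_zero[symmetric])
  \<comment> \<open>The trace is at least \<open>r\<close>, and the estimate
    \<open>2 N / D^2 \<le> 2 / D\<close> costs the 2 in \<open>r - 2\<close>.\<close>
  also have "\<dots> \<le> (\<integral>x. (\<Sum>\<alpha>\<in>J. F' \<alpha> x) \<partial>gauss J)"
  proof (rule integral_mono)
    fix x
    have "(\<Sum>\<alpha>\<in>J. F' \<alpha> x) = tr / D x - 2 * N x / (D x)\<^sup>2"
      unfolding F'_def sum_subtractf tr_def N_def by (simp add: sum_divide_distrib sum_distrib_left)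
    moreover have "N x / (D x)\<^sup>2 \<le> D x / (D x)\<^sup>2"
      using e by (intro divide_right_mono) (auto simp: D_def)
    hence "N x / (D x)\<^sup>2 \<le> 1 / D x" using D0(1)[of x] by (simp add: power2_eq_square)
    moreover have "r / D x \<le> tr / D x"
      using r D0(1)[of x] by (intro divide_right_mono) (auto simp: tr_def)
    ultimately show "(r - 2) * (1 / D x) \<le> (\<Sum>\<alpha>\<in>J. F' \<alpha> x)"
      by (simp add: diff_divide_distrib)
  next
    show "integrable (gauss J) (\<lambda>x. (r - 2) * (1 / D x))"
      by (intro integrable_mult_right int1D)
    show "integrable (gauss J) (\<lambda>x. \<Sum>\<alpha>\<in>J. F' \<alpha> x)"
      by (intro Bochner_Integration.integrable_sum intF')
  qed
  also have "\<dots> = (\<Sum>\<alpha>\<in>J. \<integral>x. F' \<alpha> x \<partial>gauss J)"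
    by (intro Bochner_Integration.integral_sum intF')
  also have "\<dots> = (\<Sum>\<alpha>\<in>J. \<integral>x. x \<alpha> * F \<alpha> x \<partial>gauss J)"
    using stein by simp
  also have "\<dots> = (\<integral>x. (\<Sum>\<alpha>\<in>J. x \<alpha> * F \<alpha> x) \<partial>gauss J)"
    by (intro Bochner_Integration.integral_sum[symmetric] intF)
  also have "\<dots> = (\<integral>x. N x / D x \<partial>gauss J)"
    by (simp add: F_def xQ[symmetric] sum_divide_distrib)
  also have "\<dots> \<le> (\<integral>x. 1 \<partial>gauss J)"
    using N0 D0 e by (intro integral_mono intN) (auto simp: divide_le_eq D_def)
  also have "\<dots> = 1" by (simp add: G.prob_space del: space_gauss)
  finally have "(\<integral>x. 1 / D x \<partial>gauss J) \<le> 1 / (r - 2)"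
    using r by (simp add: field_simps)
  moreover have "(\<integral>\<^sup>+x. ennreal (1 / D x) \<partial>gauss J) = ennreal (\<integral>x. 1 / D x \<partial>gauss J)"
    using D0 by (intro nn_integral_eq_integral int1D) (auto simp: less_imp_le)
  ultimately show ?thesis
    unfolding D_def N_def Q_def by (simp add: ennreal_leI)
qed

text \<open>Fatou's lemma along \<open>e = 1 / (i + 1)\<close>: the regularized bound does not
  depend on \<open>e\<close>. Where \<open>P x\<close> vanishes, the integrand is
  \<open>1 / 0 = 0\<close>, so the pointwise estimate is trivial there.\<close>

lemma nn_integral_inverse_proj:
  fixes P :: "'i \<Rightarrow> 'i \<Rightarrow> real" and r :: real
  assumes fin: "finite J"
    and sym: "\<And>\<alpha> \<beta>. \<alpha> \<in> J \<Longrightarrow> \<beta> \<in> J \<Longrightarrow> P \<alpha> \<beta> = P \<beta> \<alpha>"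
    and idem: "\<And>\<alpha> \<beta>. \<alpha> \<in> J \<Longrightarrow> \<beta> \<in> J \<Longrightarrow> (\<Sum>\<gamma>\<in>J. P \<alpha> \<gamma> * P \<gamma> \<beta>) = P \<alpha> \<beta>"
    and r: "r \<le> (\<Sum>\<alpha>\<in>J. P \<alpha> \<alpha>)" "2 < r"
  shows "(\<integral>\<^sup>+x. ennreal (1 / (\<Sum>\<alpha>\<in>J. (\<Sum>\<beta>\<in>J. P \<alpha> \<beta> * x \<beta>)\<^sup>2)) \<partial>gauss J) \<le> ennreal (1 / (r - 2))"
proof -
  define N where "N x = (\<Sum>\<alpha>\<in>J. (\<Sum>\<beta>\<in>J. P \<alpha> \<beta> * x \<beta>)\<^sup>2)" for x
  have [measurable]: "N \<in> borel_measurable (gauss J)"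
    unfolding N_def by measurable
  have "ennreal (1 / N x) \<le> liminf (\<lambda>i. ennreal (1 / (N x + 1 / real (Suc i))))" for x
  proof (cases "N x = 0")
    case False
    have "(\<lambda>i. 1 / (N x + 1 / real (Suc i))) \<longlonglongrightarrow> 1 / (N x + 0)"
      using False by (intro tendsto_intros lim_1_over_n[THEN LIMSEQ_Suc]) auto
    hence "(\<lambda>i. ennreal (1 / (N x + 1 / real (Suc i)))) \<longlonglongrightarrow> ennreal (1 / (N x + 0))"
      by (rule tendsto_ennrealI)
    from lim_imp_Liminf[OF _ this] show ?thesis by simp
  qed auto
  hence "(\<integral>\<^sup>+x. ennreal (1 / N x) \<partial>gauss J)
      \<le> (\<integral>\<^sup>+x. liminf (\<lambda>i. ennreal (1 / (N x + 1 / real (Suc i)))) \<partial>gauss J)"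
    by (intro nn_integral_mono)
  also have "\<dots> \<le> liminf (\<lambda>i. \<integral>\<^sup>+x. ennreal (1 / (N x + 1 / real (Suc i))) \<partial>gauss J)"
    by (rule nn_integral_liminf) measurable
  also have "\<dots> \<le> liminf (\<lambda>i::nat. ennreal (1 / (r - 2)))"
    unfolding N_def
    by (intro Liminf_mono always_eventually allI nn_integral_inverse_proj_regularized assms) auto
  also have "\<dots> = ennreal (1 / (r - 2))"
    by (rule Liminf_const) simp
  finally show ?thesis unfolding N_def .
qed

section \<open>Second moments of Gaussian linear forms\<close>

lemma nn_integral_std_normal_affine_square:
  "(\<integral>\<^sup>+t. ennreal ((s + a * t)\<^sup>2) \<partial>std_normal_distribution) = ennreal (s\<^sup>2 + a\<^sup>2)"
proof -
  interpret prob_space std_normal_distribution by (rule prob_space_std_normal)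
  have i: "integrable std_normal_distribution (\<lambda>t. t)" "integrable std_normal_distribution (\<lambda>t. t\<^sup>2)"
    using integrable_std_normal_distribution_moment[of 1] integrable_std_normal_distribution_moment[of 2] by simp_all
  have m: "(\<integral>t. t \<partial>std_normal_distribution) = 0" "(\<integral>t. t\<^sup>2 \<partial>std_normal_distribution) = 1"
    using integral_std_normal_distribution_moment_odd[of 1] std_normal_distribution_even_moments_abs[of 1]
    by simp_all
  have e: "(s + a * t)\<^sup>2 = s\<^sup>2 + (2 * s * a) * t + a\<^sup>2 * t\<^sup>2" for t
    by (simp add: power2_eq_square algebra_simps)
  have "(\<integral>\<^sup>+t. ennreal ((s + a * t)\<^sup>2) \<partial>std_normal_distribution)
      = ennreal (\<integral>t. (s + a * t)\<^sup>2 \<partial>std_normal_distribution)"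
  proof (rule nn_integral_eq_integral)
    show "integrable std_normal_distribution (\<lambda>t. (s + a * t)\<^sup>2)"
      unfolding e using i by simp
  qed simp
  also have "(\<integral>t. (s + a * t)\<^sup>2 \<partial>std_normal_distribution) = s\<^sup>2 + a\<^sup>2"
    unfolding e using i m prob_space by simp
  finally show ?thesis .
qed

text \<open>Integrating out the inserted coordinate first, with the remaining terms acting as a
  constant shift, adds \<open>(a i)^2\<close>, since this coordinate has mean 0 and variance
  1.\<close>

lemma nn_integral_gauss_linear_form_square:
  assumes "finite J"
  shows "(\<integral>\<^sup>+x. ennreal ((s + (\<Sum>\<alpha>\<in>J. a \<alpha> * x \<alpha>))\<^sup>2) \<partial>gauss J) = ennreal (s\<^sup>2 + (\<Sum>\<alpha>\<in>J. (a \<alpha>)\<^sup>2))"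
  using assms
proof (induction J arbitrary: s rule: finite_induct)
  case empty
  interpret prob_space "gauss {}" by (rule prob_space_gauss)
  show ?case
    by (simp only: sum.empty add_0_right nn_integral_const emeasure_space_1 mult_1_right)
next
  case (insert i J)
  have "(\<integral>\<^sup>+x. ennreal ((s + (\<Sum>\<alpha>\<in>insert i J. a \<alpha> * x \<alpha>))\<^sup>2) \<partial>gauss (insert i J))
      = (\<integral>\<^sup>+x. (\<integral>\<^sup>+t. ennreal ((s + (\<Sum>\<alpha>\<in>insert i J. a \<alpha> * (x(i := t)) \<alpha>))\<^sup>2) \<partial>std_normal_distribution) \<partial>gauss J)"
    unfolding gauss_def using insert.hyps by (intro std_normal_prod.product_nn_integral_insert) measurable
  also have "\<dots> = (\<integral>\<^sup>+x. (\<integral>\<^sup>+t. ennreal (((s + (\<Sum>\<alpha>\<in>J. a \<alpha> * x \<alpha>)) + a i * t)\<^sup>2) \<partial>std_normal_distribution) \<partial>gauss J)"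
  proof -
    have "(\<Sum>\<alpha>\<in>insert i J. a \<alpha> * (x(i := t)) \<alpha>) = (\<Sum>\<alpha>\<in>J. a \<alpha> * x \<alpha>) + a i * t" for x t
      using insert.hyps by (simp, intro sum.cong) auto
    thus ?thesis by (simp add: add.assoc)
  qed
  also have "\<dots> = (\<integral>\<^sup>+x. ennreal ((s + (\<Sum>\<alpha>\<in>J. a \<alpha> * x \<alpha>))\<^sup>2) + ennreal ((a i)\<^sup>2) \<partial>gauss J)"
    by (simp add: nn_integral_std_normal_affine_square)
  also have "\<dots> = (\<integral>\<^sup>+x. ennreal ((s + (\<Sum>\<alpha>\<in>J. a \<alpha> * x \<alpha>))\<^sup>2) \<partial>gauss J) + ennreal ((a i)\<^sup>2)"
    using prob_space.emeasure_space_1[OF prob_space_gauss[of J]]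
    by (subst nn_integral_add) (simp_all del: space_gauss)
  also have "\<dots> = ennreal (s\<^sup>2 + (\<Sum>\<alpha>\<in>insert i J. (a \<alpha>)\<^sup>2))"
    using insert.hyps by (simp add: insert.IH ennreal_plus[symmetric] sum_nonneg add_ac del: ennreal_plus)
  finally show ?case .
qed

section \<open>Resampling a block of coordinates independently\<close>

lemma nn_integral_gauss_split:
  assumes "finite I" "J \<subseteq> I" and f: "f \<in> borel_measurable (gauss I)"
  shows "(\<integral>\<^sup>+x. f x \<partial>gauss I) = (\<integral>\<^sup>+x. (\<integral>\<^sup>+z. f (merge (I - J) J (x, z)) \<partial>gauss J) \<partial>gauss (I - J))"
proof -
  have I: "(I - J) \<union> J = I" using assms by auto
  show ?thesis
    using std_normal_prod.product_nn_integral_fold[of "I - J" J f] assms finite_subset[OF assms(2,1)]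
    unfolding gauss_def I by auto
qed

lemma measurable_merge_gauss:
  assumes "J \<subseteq> I"
  shows "(\<lambda>(x, z). merge (I - J) J (x, z)) \<in> measurable (gauss I \<Otimes>\<^sub>M gauss J) (gauss I)"
proof -
  have I: "(I - J) \<union> J = I" using assms by auto
  have m: "(\<lambda>p. (restrict (fst p) (I - J), snd p)) \<in> measurable (gauss I \<Otimes>\<^sub>M gauss J) (gauss (I - J) \<Otimes>\<^sub>M gauss J)"
    unfolding gauss_def
    by (intro measurable_Pair measurable_compose[OF measurable_fst measurable_restrict_subset] measurable_snd) auto
  have "merge (I - J) J \<in> measurable (gauss (I - J) \<Otimes>\<^sub>M gauss J) (gauss I)"
    using measurable_merge[of "I - J" J "\<lambda>_. std_normal_distribution"] unfolding gauss_def I .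
  from measurable_compose[OF m this] show ?thesis
    by (rule measurable_cong[THEN iffD1, rotated]) (auto simp: merge_def fun_eq_iff)
qed

text \<open>Replacing the block \<open>J\<close> by an independent copy \<open>z\<close> does not
  change the law. The inner integral ignores the entries of \<open>x\<close> in \<open>J\<close>, so
  \<open>x\<close> may range over all of \<open>I\<close>, and quantities of the untouched
  coordinates stay functions of the same \<open>x\<close>.\<close>

lemma nn_integral_gauss_resample:
  assumes "finite I" "J \<subseteq> I" and f: "f \<in> borel_measurable (gauss I)"
  shows "(\<integral>\<^sup>+x. f x \<partial>gauss I) = (\<integral>\<^sup>+x. (\<integral>\<^sup>+z. f (merge (I - J) J (x, z)) \<partial>gauss J) \<partial>gauss I)"
proof -
  define g where "g x = (\<integral>\<^sup>+z. f (merge (I - J) J (x, z)) \<partial>gauss J)" for x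
  interpret J: prob_space "gauss J" by (rule prob_space_gauss)
  have g: "g \<in> borel_measurable (gauss I)"
    unfolding g_def
    using J.borel_measurable_nn_integral_fst[of "\<lambda>p. f (merge (I - J) J p)" "gauss I"]
      measurable_compose[OF measurable_merge_gauss[OF assms(2)] f] by (simp add: case_prod_beta)
  have g_merge: "g (merge (I - J) J (x, z)) = g x" for x z
    unfolding g_def by (intro nn_integral_cong arg_cong[of _ _ f]) (auto simp: merge_def)
  have "(\<integral>\<^sup>+x. g x \<partial>gauss I) = (\<integral>\<^sup>+x. (\<integral>\<^sup>+z. g x \<partial>gauss J) \<partial>gauss (I - J))"
    by (simp add: nn_integral_gauss_split[OF assms(1,2) g] g_merge)
  also have "\<dots> = (\<integral>\<^sup>+x. g x \<partial>gauss (I - J))"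
    using J.emeasure_space_1 by (simp del: space_gauss)
  also have "\<dots> = (\<integral>\<^sup>+x. f x \<partial>gauss I)"
    unfolding g_def by (rule nn_integral_gauss_split[OF assms, symmetric])
  finally show ?thesis unfolding g_def ..
qed

section \<open>Orthogonal projection away from a list of vectors\<close>

definition inner_on :: "'i set \<Rightarrow> ('i \<Rightarrow> real) \<Rightarrow> ('i \<Rightarrow> real) \<Rightarrow> real" where
  "inner_on J u v = (\<Sum>\<alpha>\<in>J. u \<alpha> * v \<alpha>)"

text \<open>If \<open>w\<close> already lies in the span of \<open>ws\<close>, the quotient below is \<open>0 / 0 = 0\<close> and the
  projection stays as it is, so no linear independence is needed.\<close>

primrec proj_compl :: "'i set \<Rightarrow> ('i \<Rightarrow> real) list \<Rightarrow> ('i \<Rightarrow> real) \<Rightarrow> 'i \<Rightarrow> real" where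
  "proj_compl J [] v = v"
| "proj_compl J (w # ws) v =
    (\<lambda>\<alpha>. proj_compl J ws v \<alpha> - inner_on J (proj_compl J ws v) (proj_compl J ws w)
       / inner_on J (proj_compl J ws w) (proj_compl J ws w) * proj_compl J ws w \<alpha>)"

lemma inner_on_commute: "inner_on J u v = inner_on J v u"
  unfolding inner_on_def by (simp add: mult.commute)

lemma inner_on_diff_scale_left: "inner_on J (\<lambda>\<alpha>. u \<alpha> - c * w \<alpha>) v = inner_on J u v - c * inner_on J w v"
  unfolding inner_on_def by (simp add: left_diff_distrib sum_subtractf sum_distrib_left mult.assoc)

lemma inner_on_diff_scale_right: "inner_on J v (\<lambda>\<alpha>. u \<alpha> - c * w \<alpha>) = inner_on J v u - c * inner_on J v w"
  using inner_on_diff_scale_left[of J u c w v] by (simp add: inner_on_commute)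

lemma inner_on_self_eq_0D: "finite J \<Longrightarrow> inner_on J w w = 0 \<Longrightarrow> \<alpha> \<in> J \<Longrightarrow> w \<alpha> = 0"
  unfolding inner_on_def by (subst (asm) sum_nonneg_eq_0_iff) auto

lemma inner_on_unit: "finite J \<Longrightarrow> \<alpha> \<in> J \<Longrightarrow> inner_on J v (\<lambda>\<gamma>. of_bool (\<gamma> = \<alpha>)) = v \<alpha>"
  unfolding inner_on_def by (simp add: sum.delta of_bool_def if_distrib cong: if_cong)

lemma inner_on_proj_compl_Cons:
  "inner_on J (proj_compl J (w # ws) u) v = inner_on J (proj_compl J ws u) v
     - inner_on J (proj_compl J ws u) (proj_compl J ws w) / inner_on J (proj_compl J ws w) (proj_compl J ws w)
       * inner_on J (proj_compl J ws w) v"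
  by (simp only: proj_compl.simps inner_on_diff_scale_left)

text \<open>This one identity encodes both self-adjointness and idempotence of
  \<open>proj_compl J ws\<close>. In the induction step the two surplus correction terms cancel
  against each other; if \<open>?w\<close> has norm zero, both contain the quotient
  \<open>0 / 0 = 0\<close>.\<close>

lemma inner_on_proj_compl: "inner_on J (proj_compl J ws u) v = inner_on J (proj_compl J ws u) (proj_compl J ws v)"
proof (induction ws arbitrary: u v)
  case (Cons w ws)
  let ?u = "proj_compl J ws u" and ?v = "proj_compl J ws v" and ?w = "proj_compl J ws w"
  have "inner_on J (proj_compl J (w # ws) u) (proj_compl J (w # ws) v)
      = inner_on J ?u ?v - inner_on J ?v ?w / inner_on J ?w ?w * inner_on J ?u ?w
        - inner_on J ?u ?w / inner_on J ?w ?w * (inner_on J ?w ?v - inner_on J ?v ?w / inner_on J ?w ?w * inner_on J ?w ?w)"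
    unfolding inner_on_proj_compl_Cons unfolding proj_compl.simps inner_on_diff_scale_right ..
  also have "\<dots> = inner_on J ?u ?v - inner_on J ?u ?w / inner_on J ?w ?w * inner_on J ?w ?v"
    unfolding inner_on_commute[of J ?w ?v] by (cases "inner_on J ?w ?w = 0") simp_all
  also have "\<dots> = inner_on J (proj_compl J (w # ws) u) v"
    unfolding inner_on_proj_compl_Cons Cons.IH[of u v] Cons.IH[of w v] ..
  finally show ?case ..
qed simp

lemma inner_on_proj_compl_selfadjoint: "inner_on J u (proj_compl J ws v) = inner_on J (proj_compl J ws u) v"
  using inner_on_proj_compl[of J ws v u] inner_on_proj_compl[of J ws u v] by (simp add: inner_on_commute)

text \<open>For the head of the list, the subtracted multiple is the one that cancels the inner
  product; if the residual of the head has norm zero, it vanishes on \<open>J\<close> and the inner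
  product is 0 anyway. For the vectors in the tail both terms vanish by induction.\<close>

lemma inner_on_proj_compl_eq_0:
  assumes "finite J" "w \<in> set ws"
  shows "inner_on J (proj_compl J ws v) w = 0"
  using assms(2)
proof (induction ws arbitrary: v)
  case (Cons x ws)
  show ?case
  proof (cases "w = x")
    case True
    show ?thesis
    proof (cases "inner_on J (proj_compl J ws x) (proj_compl J ws x) = 0")
      case 0: True
      have "inner_on J (proj_compl J ws v) (proj_compl J ws x) = 0"
        using inner_on_self_eq_0D[OF assms(1) 0] unfolding inner_on_def by (intro sum.neutral) auto
      thus ?thesis using True 0
        by (simp add: inner_on_proj_compl_Cons inner_on_proj_compl[of J ws _ x] del: proj_compl.simps)
    qed (use True in \<open>simp add: inner_on_proj_compl_Cons inner_on_proj_compl[of J ws _ x] del: proj_compl.simps\<close>)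
  next
    case False
    thus ?thesis using Cons by (simp add: inner_on_proj_compl_Cons del: proj_compl.simps)
  qed
qed simp

text \<open>The vectors are indexed through \<open>f\<close> over distinct \<open>xs\<close> so that
  coefficients belong to indices; equal vectors under different indices are harmless.\<close>

lemma proj_compl_decomp:
  assumes "distinct xs"
  shows "\<exists>c. \<forall>\<alpha>. v \<alpha> = proj_compl J (map f xs) v \<alpha> + (\<Sum>z\<in>set xs. c z * f z \<alpha>)"
  using assms
proof (induction xs arbitrary: v)
  case (Cons x xs)
  let ?P = "proj_compl J (map f xs)"
  obtain c where c: "\<And>\<alpha>. v \<alpha> = ?P v \<alpha> + (\<Sum>z\<in>set xs. c z * f z \<alpha>)"
    using Cons by fastforce
  obtain d where d: "\<And>\<alpha>. f x \<alpha> = ?P (f x) \<alpha> + (\<Sum>z\<in>set xs. d z * f z \<alpha>)"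
    using Cons by fastforce
  \<comment> \<open>The residual of \<open>f x\<close> is traded for \<open>f x\<close> minus its
    own combination with coefficients \<open>d\<close>, which changes the other coefficients to
    \<open>c z - b * d z\<close>.\<close>
  define b where "b = inner_on J (?P v) (?P (f x)) / inner_on J (?P (f x)) (?P (f x))"
  have "v \<alpha> = proj_compl J (map f (x # xs)) v \<alpha>
      + (\<Sum>z\<in>set (x # xs). (if z = x then b else c z - b * d z) * f z \<alpha>)" for \<alpha>
  proof -
    have "(\<Sum>z\<in>set (x # xs). (if z = x then b else c z - b * d z) * f z \<alpha>)
        = b * f x \<alpha> + (\<Sum>z\<in>set xs. (c z - b * d z) * f z \<alpha>)"
      using Cons.prems by (simp, intro sum.cong) auto
    also have "\<dots> = b * f x \<alpha> + (\<Sum>z\<in>set xs. c z * f z \<alpha>) - b * (\<Sum>z\<in>set xs. d z * f z \<alpha>)"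
      by (simp add: left_diff_distrib sum_subtractf sum_distrib_left mult.assoc)
    also have "\<dots> = b * ?P (f x) \<alpha> + (v \<alpha> - ?P v \<alpha>)"
      by (subst d, subst c) (simp add: algebra_simps)
    finally show ?thesis by (simp add: b_def)
  qed
  thus ?case by (intro exI[of _ "\<lambda>z. if z = x then b else c z - b * d z"] allI)
qed simp

text \<open>Linearity follows from self-adjointness: the entry at \<open>\<alpha>\<close> is an
  inner product with a unit vector, onto which the projection can be moved. In particular the values
  on \<open>J\<close> depend only on \<open>v\<close> restricted to \<open>J\<close>.\<close>

lemma proj_compl_matrix:
  assumes "finite J" "\<alpha> \<in> J"
  shows "proj_compl J ws v \<alpha> = (\<Sum>\<beta>\<in>J. proj_compl J ws (\<lambda>\<gamma>. of_bool (\<gamma> = \<beta>)) \<alpha> * v \<beta>)"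
proof -
  let ?e = "\<lambda>\<beta> \<gamma>. of_bool (\<gamma> = \<beta>) :: real"
  have "proj_compl J ws v \<alpha> = inner_on J (proj_compl J ws v) (?e \<alpha>)"
    by (simp add: inner_on_unit assms)
  also have "\<dots> = inner_on J v (proj_compl J ws (?e \<alpha>))"
    by (simp add: inner_on_proj_compl_selfadjoint)
  also have "\<dots> = (\<Sum>\<beta>\<in>J. proj_compl J ws (?e \<alpha>) \<beta> * v \<beta>)"
    unfolding inner_on_def by (simp add: mult.commute)
  also have "\<dots> = (\<Sum>\<beta>\<in>J. proj_compl J ws (?e \<beta>) \<alpha> * v \<beta>)"
  proof (rule sum.cong)
    fix \<beta> assume "\<beta> \<in> J"
    hence "proj_compl J ws (?e \<alpha>) \<beta> = inner_on J (proj_compl J ws (?e \<alpha>)) (?e \<beta>)"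
      by (simp add: inner_on_unit assms)
    also have "\<dots> = inner_on J (proj_compl J ws (?e \<beta>)) (?e \<alpha>)"
      by (subst inner_on_proj_compl_selfadjoint[symmetric]) (rule inner_on_commute)
    also have "\<dots> = proj_compl J ws (?e \<beta>) \<alpha>"
      by (simp add: inner_on_unit assms)
    finally show "proj_compl J ws (?e \<alpha>) \<beta> * v \<beta> = proj_compl J ws (?e \<beta>) \<alpha> * v \<beta>" by simp
  qed simp
  finally show ?thesis .
qed

text \<open>Each removed vector lowers the trace by the quotient of the squared norm of its residual
  \<open>w'\<close> by itself, which is 1, or \<open>0 / 0 = 0\<close> if \<open>w'\<close> vanishes
  on \<open>J\<close>.\<close>

lemma proj_compl_trace:
  assumes "finite J"
  shows "real (card J) - real (length ws) \<le> (\<Sum>\<alpha>\<in>J. proj_compl J ws (\<lambda>\<gamma>. of_bool (\<gamma> = \<alpha>)) \<alpha>)"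
proof (induction ws)
  case (Cons w ws)
  let ?e = "\<lambda>\<beta> \<gamma>. of_bool (\<gamma> = \<beta>) :: real"
  define w' where "w' = proj_compl J ws w"
  have "(\<Sum>\<alpha>\<in>J. proj_compl J (w # ws) (?e \<alpha>) \<alpha>)
      = (\<Sum>\<alpha>\<in>J. proj_compl J ws (?e \<alpha>) \<alpha> - w' \<alpha> * w' \<alpha> / inner_on J w' w')"
  proof (rule sum.cong)
    fix \<alpha> assume "\<alpha> \<in> J"
    hence "inner_on J (proj_compl J ws (?e \<alpha>)) w' = w' \<alpha>"
      unfolding w'_def
      by (metis inner_on_proj_compl inner_on_proj_compl_selfadjoint inner_on_commute inner_on_unit[OF assms])
    thus "proj_compl J (w # ws) (?e \<alpha>) \<alpha> = proj_compl J ws (?e \<alpha>) \<alpha> - w' \<alpha> * w' \<alpha> / inner_on J w' w'"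
      by (simp add: w'_def)
  qed simp
  also have "\<dots> = (\<Sum>\<alpha>\<in>J. proj_compl J ws (?e \<alpha>) \<alpha>) - inner_on J w' w' / inner_on J w' w'"
    by (simp only: sum_subtractf sum_divide_distrib[symmetric] inner_on_def)
  finally have "(\<Sum>\<alpha>\<in>J. proj_compl J (w # ws) (?e \<alpha>) \<alpha>)
      = (\<Sum>\<alpha>\<in>J. proj_compl J ws (?e \<alpha>) \<alpha>) - inner_on J w' w' / inner_on J w' w'" .
  moreover have "inner_on J w' w' / inner_on J w' w' \<le> 1"
    by (simp add: divide_self_if)
  ultimately show ?case
    using Cons.IH by (simp only: length_Cons of_nat_Suc)
qed simp

text \<open>The list consists of functions of \<open>x\<close>, so its length is fixed and one
  induction serves all \<open>x\<close> at once.\<close>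

lemma borel_measurable_proj_compl:
  assumes "\<And>w \<beta>. w \<in> set ws \<Longrightarrow> \<beta> \<in> J \<Longrightarrow> (\<lambda>x. w x \<beta>) \<in> borel_measurable M"
    and "\<And>\<beta>. \<beta> \<in> J \<Longrightarrow> (\<lambda>x. v x \<beta>) \<in> borel_measurable M" and "\<alpha> \<in> J"
  shows "(\<lambda>x. proj_compl J (map (\<lambda>w. w x) ws) (v x) \<alpha>) \<in> borel_measurable M"
  using assms
proof (induction ws arbitrary: v \<alpha>)
  case (Cons w ws)
  have [measurable]: "(\<lambda>x. proj_compl J (map (\<lambda>w. w x) ws) (w x) \<beta>) \<in> borel_measurable M"
    "(\<lambda>x. proj_compl J (map (\<lambda>w. w x) ws) (v x) \<beta>) \<in> borel_measurable M" if "\<beta> \<in> J" for \<beta>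
    using Cons that by auto
  have "(\<lambda>x. inner_on J (f x) (g x)) \<in> borel_measurable M"
    if "\<And>\<beta>. \<beta> \<in> J \<Longrightarrow> (\<lambda>x. f x \<beta>) \<in> borel_measurable M"
      "\<And>\<beta>. \<beta> \<in> J \<Longrightarrow> (\<lambda>x. g x \<beta>) \<in> borel_measurable M" for f g
    using that unfolding inner_on_def by (intro borel_measurable_sum borel_measurable_times)
  thus ?case
    using Cons.prems(3) unfolding list.map proj_compl.simps
    by (intro borel_measurable_diff borel_measurable_times borel_measurable_divide) auto
qed simp

text \<open>The vectors \<open>ws\<close> are fixed here; for Gaussian rows the bound is applied
  conditionally on the other rows.\<close>

lemma nn_integral_inverse_proj_compl:
  assumes "finite J" and "real (length ws) + 2 < real (card J)"
  shows "(\<integral>\<^sup>+x. ennreal (1 / inner_on J (proj_compl J ws x) (proj_compl J ws x)) \<partial>gauss J)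
    \<le> ennreal (1 / (real (card J) - real (length ws) - 2))"
proof -
  let ?e = "\<lambda>\<beta> \<gamma>. of_bool (\<gamma> = \<beta>) :: real"
  define P where "P \<alpha> \<beta> = proj_compl J ws (?e \<beta>) \<alpha>" for \<alpha> \<beta>
  have P: "P \<alpha> \<beta> = inner_on J (proj_compl J ws (?e \<alpha>)) (proj_compl J ws (?e \<beta>))" if "\<alpha> \<in> J" for \<alpha> \<beta>
    unfolding P_def
    by (metis inner_on_proj_compl inner_on_commute inner_on_unit[OF assms(1) that])
  have "(\<integral>\<^sup>+x. ennreal (1 / (\<Sum>\<alpha>\<in>J. (\<Sum>\<beta>\<in>J. P \<alpha> \<beta> * x \<beta>)\<^sup>2)) \<partial>gauss J)
      \<le> ennreal (1 / (real (card J) - real (length ws) - 2))"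
  proof (rule nn_integral_inverse_proj[OF assms(1)])
    show "P \<alpha> \<beta> = P \<beta> \<alpha>" if "\<alpha> \<in> J" "\<beta> \<in> J" for \<alpha> \<beta>
      using P that by (simp add: inner_on_commute)
    show "(\<Sum>\<gamma>\<in>J. P \<alpha> \<gamma> * P \<gamma> \<beta>) = P \<alpha> \<beta>" if "\<alpha> \<in> J" "\<beta> \<in> J" for \<alpha> \<beta>
    proof -
      have "(\<Sum>\<gamma>\<in>J. P \<alpha> \<gamma> * P \<gamma> \<beta>) = (\<Sum>\<gamma>\<in>J. P \<gamma> \<alpha> * P \<gamma> \<beta>)"
        using P that by (intro sum.cong) (auto simp: inner_on_commute)
      thus ?thesis
        using P[OF that(1)] by (simp add: P_def inner_on_def)
    qed
    show "real (card J) - real (length ws) \<le> (\<Sum>\<alpha>\<in>J. P \<alpha> \<alpha>)"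
      unfolding P_def by (rule proj_compl_trace[OF assms(1)])
  qed (use assms in auto)
  moreover have "inner_on J (proj_compl J ws x) (proj_compl J ws x) = (\<Sum>\<alpha>\<in>J. (\<Sum>\<beta>\<in>J. P \<alpha> \<beta> * x \<beta>)\<^sup>2)" for x
    unfolding inner_on_def P_def power2_eq_square
    by (intro sum.cong refl) (simp add: proj_compl_matrix[OF assms(1), symmetric])
  ultimately show ?thesis by simp
qed

section \<open>Rows of quaternion Gaussian matrices\<close>

definition qunit :: "nat \<Rightarrow> quat" where
  "qunit d = Quat (of_bool (d = 0)) (of_bool (d = 1)) (of_bool (d = 2)) (of_bool (d = 3))"

lemma qunit_sel [simp]: "qre (qunit d) = of_bool (d = 0)" "qim1 (qunit d) = of_bool (d = 1)"
    "qim2 (qunit d) = of_bool (d = 2)" "qim3 (qunit d) = of_bool (d = 3)"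
  by (simp_all add: qunit_def)

lemma quat_comp_simps [simp]:
  "quat_comp 0 x = qre x" "quat_comp (Suc 0) x = qim1 x" "quat_comp 1 x = qim1 x" "quat_comp 2 x = qim2 x"
  "quat_comp 3 x = qim3 x"
  by (simp_all add: quat_comp_def eval_nat_numeral)

lemma sum_lessThan_4: "(\<Sum>c<4. f c) = f 0 + f 1 + f 2 + f (3::nat)"
  by (simp add: eval_nat_numeral)

lemma less_4_cases: "(c::nat) < 4 \<longleftrightarrow> c = 0 \<or> c = 1 \<or> c = 2 \<or> c = 3"
  by auto

lemma quat_sum_sel:
  "qre (sum f S) = (\<Sum>x\<in>S. qre (f x))" "qim1 (sum f S) = (\<Sum>x\<in>S. qim1 (f x))"
  "qim2 (sum f S) = (\<Sum>x\<in>S. qim2 (f x))" "qim3 (sum f S) = (\<Sum>x\<in>S. qim3 (f x))"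
  by (induction S rule: infinite_finite_induct; simp)+

lemma qre_mult_qcnj: "qre (x * qcnj y) = inner x y"
  by (simp add: inner_quat_def)

lemma norm_qcnj [simp]: "norm (qcnj x) = norm x"
  by (simp add: norm_quat_def)

text \<open>Up to sign, the real parts of the four unit multiples of \<open>x\<close> are its
  components.\<close>

lemma quat_eq_0I:
  assumes "\<And>d. d < 4 \<Longrightarrow> qre (qunit d * x) = 0"
  shows "x = 0"
  using assms[of 0] assms[of 1] assms[of 2] assms[of 3] by (simp add: quat_eq_iff)

text \<open>Multiplication by a unit preserves the norm; this factor 4 becomes the 4 in the
  numerator of the final bound.\<close>

lemma norm_qunit_mult_sum: "(\<Sum>d<4. (norm (qunit d * x))\<^sup>2) = 4 * (norm x)\<^sup>2"
  by (simp add: sum_lessThan_4 norm_mult norm_quat_def)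

text \<open>A family of real coordinates is indexed by triples (quaternion component, row, column).\<close>

definition entry :: "(nat \<times> nat \<times> nat \<Rightarrow> real) \<Rightarrow> nat \<Rightarrow> nat \<Rightarrow> quat" where
  "entry x j s = Quat (x (0, j, s)) (x (1, j, s)) (x (2, j, s)) (x (3, j, s))"

lemma entry_sel [simp]: "qre (entry x j s) = x (0, j, s)" "qim1 (entry x j s) = x (1, j, s)"
    "qim2 (entry x j s) = x (2, j, s)" "qim3 (entry x j s) = x (3, j, s)"
  by (simp_all add: entry_def)

definition block :: "nat \<Rightarrow> nat \<Rightarrow> (nat \<times> nat \<times> nat) set" where
  "block l j = {..<4} \<times> {j} \<times> {..<l}"

lemma finite_block [simp]: "finite (block l j)"
  by (simp add: block_def)

lemma card_block: "card (block l j) = 4 * l"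
  by (simp add: block_def)

lemma sum_block: "(\<Sum>\<alpha>\<in>block l j. f \<alpha>) = (\<Sum>c<4. \<Sum>s<l. f (c, j, s))"
proof -
  have "block l j = (\<lambda>(c, s). (c, j, s)) ` ({..<4} \<times> {..<l})"
    by (auto simp: block_def)
  moreover have "inj_on (\<lambda>(c, s). (c, j, s)) ({..<4::nat} \<times> {..<l})"
    by (auto simp: inj_on_def)
  ultimately show ?thesis
    by (simp add: sum.reindex sum.cartesian_product case_prod_unfold)
qed

lemma inner_on_block: "inner_on (block l j) u v = (\<Sum>s<l. inner (entry u j s) (entry v j s))"
  by (simp add: inner_on_def sum_block sum_lessThan_4 inner_quat_def sum.distrib)

text \<open>The row index of the argument is ignored, so that row \<open>j\<close> is also a vector on every other
  \<^term>\<open>block l i\<close>.\<close>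

definition qrow :: "nat \<Rightarrow> nat \<Rightarrow> (nat \<times> nat \<times> nat \<Rightarrow> real) \<Rightarrow> nat \<times> nat \<times> nat \<Rightarrow> real" where
  "qrow d j x = (\<lambda>(c, _, s). quat_comp c (qunit d * entry x j s))"

lemma entry_qrow: "entry (qrow d j x) i s = qunit d * entry x j s"
  by (simp add: quat_eq_iff qrow_def)

lemma entry_qrow_0 [simp]: "entry (qrow 0 j x) i s = entry x j s"
  by (simp add: entry_qrow quat_eq_iff)

section \<open>Residual of a row against the other rows, and the right inverse\<close>

definition other_index :: "nat \<Rightarrow> nat \<Rightarrow> (nat \<times> nat) list" where
  "other_index k i = List.product (filter (\<lambda>j. j \<noteq> i) [0..<k]) [0..<4]"

lemma set_other_index: "set (other_index k i) = ({..<k} - {i}) \<times> {..<4}"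
  by (auto simp: other_index_def)

lemma distinct_other_index: "distinct (other_index k i)"
  by (simp add: other_index_def distinct_product)

lemma length_other_index:
  assumes "i < k"
  shows "length (other_index k i) = 4 * (k - 1)"
proof -
  have "card (set (other_index k i)) = 4 * (k - 1)"
    unfolding set_other_index using assms by (simp add: card_cartesian_product)
  thus ?thesis by (simp add: distinct_card[OF distinct_other_index])
qed

text \<open>All four left unit multiples of each of the other first \<open>k\<close> rows are
  listed, so that their real span is the left quaternion span of these rows.\<close>

definition others :: "nat \<Rightarrow> nat \<Rightarrow> (nat \<times> nat \<times> nat \<Rightarrow> real) \<Rightarrow> (nat \<times> nat \<times> nat \<Rightarrow> real) list" where
  "others k i x = map (\<lambda>(j, d). qrow d j x) (other_index k i)"

text \<open>\<open>qunit 0\<close> is 1, so \<open>qrow 0 i x\<close> carries row \<open>i\<close>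
  itself; what remains on the block is its component orthogonal to the left span of the other
  rows.\<close>

definition resid :: "nat \<Rightarrow> nat \<Rightarrow> nat \<Rightarrow> (nat \<times> nat \<times> nat \<Rightarrow> real) \<Rightarrow> nat \<times> nat \<times> nat \<Rightarrow> real" where
  "resid k l i x = proj_compl (block l i) (others k i x) (qrow 0 i x)"

definition resid_sq :: "nat \<Rightarrow> nat \<Rightarrow> nat \<Rightarrow> (nat \<times> nat \<times> nat \<Rightarrow> real) \<Rightarrow> real" where
  "resid_sq k l i x = inner_on (block l i) (resid k l i x) (resid k l i x)"

text \<open>For nonzero residuals, column \<open>i\<close> of a right inverse of the first
  \<open>k\<close> rows; a zero residual makes it 0.\<close>

definition right_inv :: "nat \<Rightarrow> nat \<Rightarrow> nat \<Rightarrow> (nat \<times> nat \<times> nat \<Rightarrow> real) \<Rightarrow> nat \<Rightarrow> quat" where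
  "right_inv k l i x s = qcnj (entry (resid k l i x) i s) /\<^sub>R resid_sq k l i x"

lemma resid_sq_eq: "resid_sq k l i x = (\<Sum>s<l. (norm (entry (resid k l i x) i s))\<^sup>2)"
  by (simp add: resid_sq_def inner_on_block power2_norm_eq_inner)

text \<open>The real inner product is the real part of \<open>x * qcnj y\<close>. Real orthogonality
  to all four left multiples of row \<open>j\<close> therefore forces the whole quaternion product
  to vanish.\<close>

lemma resid_orthogonal:
  assumes "j < k" "j \<noteq> i"
  shows "(\<Sum>s<l. entry x j s * qcnj (entry (resid k l i x) i s)) = 0"
proof (rule quat_eq_0I)
  fix d :: nat assume d: "d < 4"
  have "qrow d j x \<in> set (others k i x)"
    using assms d by (force simp: others_def set_other_index)
  hence "0 = inner_on (block l i) (resid k l i x) (qrow d j x)"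
    unfolding resid_def by (simp add: inner_on_proj_compl_eq_0)
  also have "\<dots> = (\<Sum>s<l. qre (qunit d * (entry x j s * qcnj (entry (resid k l i x) i s))))"
    unfolding inner_on_block entry_qrow
    by (intro sum.cong refl, subst inner_commute) (simp only: qre_mult_qcnj[symmetric] mult.assoc)
  finally show "qre (qunit d * (\<Sum>s<l. entry x j s * qcnj (entry (resid k l i x) i s))) = 0"
    by (simp only: sum_distrib_left quat_sum_sel)
qed

text \<open>Real coefficients of the four unit multiples of a row assemble into one left quaternion
  coefficient \<open>C j\<close>.\<close>

lemma resid_decomp:
  "\<exists>C. \<forall>s. entry x i s = entry (resid k l i x) i s + (\<Sum>j\<in>{..<k} - {i}. C j * entry x j s)"
proof -
  obtain c where c: "\<And>\<alpha>. qrow 0 i x \<alpha> = resid k l i x \<alpha>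
      + (\<Sum>z\<in>set (other_index k i). c z * (case z of (j, d) \<Rightarrow> qrow d j x) \<alpha>)"
    using proj_compl_decomp[OF distinct_other_index, of "qrow 0 i x" "block l i" "\<lambda>(j, d). qrow d j x"]
    unfolding resid_def others_def by blast
  define C where "C j = (\<Sum>d<4. c (j, d) *\<^sub>R qunit d)" for j
  have "entry x i s = entry (resid k l i x) i s + (\<Sum>j\<in>{..<k} - {i}. C j * entry x j s)" for s
  proof -
    have "entry x i s = entry (qrow 0 i x) i s" by simp
    also have "\<dots> = entry (resid k l i x) i s
        + (\<Sum>z\<in>set (other_index k i). c z *\<^sub>R entry (case z of (j, d) \<Rightarrow> qrow d j x) i s)"
      by (intro quat_eqI) (simp_all only: entry_sel plus_quat_sel quat_sum_sel scaleR_quat_sel c)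
    also have "(\<Sum>z\<in>set (other_index k i). c z *\<^sub>R entry (case z of (j, d) \<Rightarrow> qrow d j x) i s)
        = (\<Sum>j\<in>{..<k} - {i}. \<Sum>d<4. c (j, d) *\<^sub>R (qunit d * entry x j s))"
      unfolding set_other_index sum.cartesian_product
      by (intro sum.cong refl) (auto simp: entry_qrow)
    also have "\<dots> = (\<Sum>j\<in>{..<k} - {i}. C j * entry x j s)"
      by (simp add: C_def sum_distrib_right)
    finally show ?thesis .
  qed
  thus ?thesis by blast
qed

text \<open>For \<open>j = i\<close>, row \<open>i\<close> is the residual plus a left combination
  of the other rows; orthogonality removes the combination and leaves the squared norm of the
  residual.\<close>

lemma right_inv_mult:
  assumes "j < k" "resid_sq k l i x \<noteq> 0"
  shows "(\<Sum>s<l. entry x j s * right_inv k l i x s) = of_bool (j = i)"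
proof -
  let ?y = "\<lambda>s. entry (resid k l i x) i s"
  have "(\<Sum>s<l. entry x j s * qcnj (?y s)) = resid_sq k l i x *\<^sub>R of_bool (j = i)"
  proof (cases "j = i")
    case True
    obtain C where C: "\<And>s. entry x i s = ?y s + (\<Sum>j\<in>{..<k} - {i}. C j * entry x j s)"
      using resid_decomp by blast
    have "(\<Sum>s<l. entry x i s * qcnj (?y s))
        = (\<Sum>s<l. ?y s * qcnj (?y s)) + (\<Sum>s<l. \<Sum>j\<in>{..<k} - {i}. C j * (entry x j s * qcnj (?y s)))"
      by (subst C) (simp add: distrib_right sum.distrib sum_distrib_right mult.assoc)
    also have "(\<Sum>s<l. \<Sum>j\<in>{..<k} - {i}. C j * (entry x j s * qcnj (?y s)))
        = (\<Sum>j\<in>{..<k} - {i}. C j * (\<Sum>s<l. entry x j s * qcnj (?y s)))"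
      by (subst sum.swap) (simp add: sum_distrib_left)
    also have "\<dots> = 0"
      by (intro sum.neutral ballI) (simp add: resid_orthogonal)
    also have "(\<Sum>s<l. ?y s * qcnj (?y s)) = resid_sq k l i x *\<^sub>R 1"
      unfolding resid_sq_eq qcnj_mult_self scaleR_sum_left ..
    finally show ?thesis using True by simp
  qed (use assms resid_orthogonal in simp)
  thus ?thesis
    using assms(2) by (simp add: right_inv_def scaleR_sum_right[symmetric])
qed

text \<open>The second hypothesis is left linear independence of the first \<open>k\<close> rows. A
  vanishing residual would make row \<open>i\<close> a combination of the others, a relation with
  coefficient \<open>- 1\<close> at \<open>i\<close>.\<close>

lemma resid_sq_nonzero:
  assumes "i < k"
    and "\<And>\<xi>. (\<forall>s<l. (\<Sum>j<k. \<xi> j * entry x j s) = 0) \<Longrightarrow> \<forall>j<k. \<xi> j = 0"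
  shows "resid_sq k l i x \<noteq> 0"
proof
  assume "resid_sq k l i x = 0"
  hence y: "entry (resid k l i x) i s = 0" if "s < l" for s
    using that unfolding resid_sq_eq by (subst (asm) sum_nonneg_eq_0_iff) auto
  obtain C where C: "\<And>s. entry x i s = entry (resid k l i x) i s + (\<Sum>j\<in>{..<k} - {i}. C j * entry x j s)"
    using resid_decomp by blast
  have "(\<Sum>j<k. (if j = i then - 1 else C j) * entry x j s) = 0" if "s < l" for s
  proof -
    have "(\<Sum>j<k. (if j = i then - 1 else C j) * entry x j s)
        = - entry x i s + (\<Sum>j\<in>{..<k} - {i}. C j * entry x j s)"
      using assms(1) by (subst sum.remove[of _ i]) (auto intro!: sum.cong)
    thus ?thesis using C[of s] y[OF that] by simp
  qed
  from assms(2)[of "\<lambda>j. if j = i then - 1 else C j"] this assms(1) show False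
    by fastforce
qed

text \<open>A zero residual is covered as well: both sides are then 0.\<close>

lemma sum_norm_right_inv: "(\<Sum>s<l. (norm (right_inv k l i x s))\<^sup>2) = 1 / resid_sq k l i x"
proof -
  have "(\<Sum>s<l. (norm (right_inv k l i x s))\<^sup>2)
      = (\<Sum>s<l. (norm (entry (resid k l i x) i s))\<^sup>2) / (resid_sq k l i x)\<^sup>2"
    by (simp add: right_inv_def power_mult_distrib power_inverse divide_inverse mult.commute sum_distrib_left)
  thus ?thesis
    unfolding resid_sq_eq[symmetric] by (simp add: power2_eq_square)
qed

section \<open>Componentwise measurability and Gaussian moments of rows\<close>

definition quat_measurable :: "'a measure \<Rightarrow> ('a \<Rightarrow> quat) \<Rightarrow> bool" where
  "quat_measurable M f \<longleftrightarrow> (\<lambda>x. qre (f x)) \<in> borel_measurable M \<and> (\<lambda>x. qim1 (f x)) \<in> borel_measurable M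
     \<and> (\<lambda>x. qim2 (f x)) \<in> borel_measurable M \<and> (\<lambda>x. qim3 (f x)) \<in> borel_measurable M"

lemma quat_measurable_mult:
  "quat_measurable M f \<Longrightarrow> quat_measurable M g \<Longrightarrow> quat_measurable M (\<lambda>x. f x * g x)"
  unfolding quat_measurable_def times_quat_sel
  by (auto intro!: borel_measurable_add borel_measurable_diff borel_measurable_times)

lemma quat_measurable_sum:
  "(\<And>s. s \<in> S \<Longrightarrow> quat_measurable M (f s)) \<Longrightarrow> quat_measurable M (\<lambda>x. \<Sum>s\<in>S. f s x)"
  unfolding quat_measurable_def quat_sum_sel by (auto intro!: borel_measurable_sum)

lemma quat_measurable_comp: "quat_measurable M f \<Longrightarrow> c < 4 \<Longrightarrow> (\<lambda>x. quat_comp c (f x)) \<in> borel_measurable M"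
  unfolding quat_measurable_def less_4_cases by auto

lemma quat_measurable_norm_sq:
  "quat_measurable M f \<Longrightarrow> (\<lambda>x. (norm (f x))\<^sup>2) \<in> borel_measurable M"
  unfolding quat_measurable_def norm_quat_sq
  by (auto intro!: borel_measurable_add borel_measurable_power)

text \<open>For a fixed column \<open>r\<close>, each of the four components is a real linear form
  in the Gaussian row, so its second moment is the sum of its squared coefficients. Regrouped by
  real coordinate, these add up to the squared norms of the unit multiples of \<open>r s\<close>,
  four equal terms for each \<open>s\<close>.\<close>

lemma nn_integral_norm_quat_linear:
  "(\<integral>\<^sup>+z. ennreal ((norm (\<Sum>s<l. entry z j s * r s))\<^sup>2) \<partial>gauss (block l j))
    = ennreal (4 * (\<Sum>s<l. (norm (r s))\<^sup>2))"
proof -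
  \<comment> \<open>Coordinate \<open>(c, j, s)\<close> of \<open>z\<close> enters the product with
    the factor \<open>qunit c * r s\<close>; \<open>a d\<close> collects component \<open>d\<close>
    of these factors.\<close>
  define a where "a d = (\<lambda>(c, i :: nat, s). quat_comp d (qunit c * r s))" for d
  have lin: "quat_comp d (\<Sum>s<l. entry z j s * r s) = 0 + (\<Sum>\<alpha>\<in>block l j. a d \<alpha> * z \<alpha>)" if "d < 4" for d z
    using that unfolding less_4_cases sum_block sum_lessThan_4 a_def
    by (elim disjE) (simp_all add: quat_sum_sel sum.distrib[symmetric] sum_subtractf[symmetric] algebra_simps)
  have sq: "(norm q)\<^sup>2 = (\<Sum>d<4. (quat_comp d q)\<^sup>2)" for q
    by (simp add: norm_quat_sq sum_lessThan_4)
  have "(\<integral>\<^sup>+z. ennreal ((norm (\<Sum>s<l. entry z j s * r s))\<^sup>2) \<partial>gauss (block l j))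
      = (\<integral>\<^sup>+z. (\<Sum>d<4. ennreal ((0 + (\<Sum>\<alpha>\<in>block l j. a d \<alpha> * z \<alpha>))\<^sup>2)) \<partial>gauss (block l j))"
    by (simp add: sq lin sum_ennreal)
  also have "\<dots> = (\<Sum>d<4. \<integral>\<^sup>+z. ennreal ((0 + (\<Sum>\<alpha>\<in>block l j. a d \<alpha> * z \<alpha>))\<^sup>2) \<partial>gauss (block l j))"
    by (rule nn_integral_sum) measurable
  also have "\<dots> = (\<Sum>d<4. ennreal (0\<^sup>2 + (\<Sum>\<alpha>\<in>block l j. (a d \<alpha>)\<^sup>2)))"
    by (simp only: nn_integral_gauss_linear_form_square[OF finite_block])
  also have "\<dots> = ennreal (\<Sum>d<4. \<Sum>\<alpha>\<in>block l j. (a d \<alpha>)\<^sup>2)"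
    by (simp add: sum_ennreal sum_nonneg)
  also have "(\<Sum>d<4. \<Sum>\<alpha>\<in>block l j. (a d \<alpha>)\<^sup>2) = (\<Sum>\<alpha>\<in>block l j. \<Sum>d<4. (a d \<alpha>)\<^sup>2)"
    by (rule sum.swap)
  also have "\<dots> = (\<Sum>c<4. \<Sum>s<l. (norm (qunit c * r s))\<^sup>2)"
    by (simp add: sum_block a_def sq)
  also have "\<dots> = (\<Sum>s<l. \<Sum>c<4. (norm (qunit c * r s))\<^sup>2)"
    by (rule sum.swap)
  also have "\<dots> = 4 * (\<Sum>s<l. (norm (r s))\<^sup>2)"
    by (simp only: norm_qunit_mult_sum sum_distrib_left)
  finally show ?thesis .
qed

definition index_set :: "nat \<Rightarrow> nat \<Rightarrow> (nat \<times> nat \<times> nat) set" where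
  "index_set n l = {..<4} \<times> {..<n} \<times> {..<l}"

lemma finite_index_set [simp]: "finite (index_set n l)"
  by (simp add: index_set_def)

lemma block_subset: "j < n \<Longrightarrow> block l j \<subseteq> index_set n l"
  by (auto simp: block_def index_set_def)

lemma quat_measurable_entry:
  assumes "j < n" "s < l"
  shows "quat_measurable (gauss (index_set n l)) (\<lambda>x. entry x j s)"
proof -
  have "(\<lambda>x. x (c, j, s)) \<in> borel_measurable (gauss (index_set n l))" if "c < 4" for c
    using assms that unfolding gauss_def
    by (intro measurable_compose[OF measurable_component_singleton]) (auto simp: index_set_def)
  thus ?thesis by (simp add: quat_measurable_def)
qed

lemma borel_measurable_resid:
  assumes "i < k" "k \<le> n" "\<alpha> \<in> block l i"
  shows "(\<lambda>x. resid k l i x \<alpha>) \<in> borel_measurable (gauss (index_set n l))"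
proof -
  let ?G = "gauss (index_set n l)"
  have row: "(\<lambda>x. qrow d j x \<beta>) \<in> borel_measurable ?G" if "j < k" "\<beta> \<in> block l i" for d j \<beta>
  proof -
    obtain c s where \<beta>: "\<beta> = (c, i, s)" "c < 4" "s < l"
      using \<open>\<beta> \<in> block l i\<close> by (auto simp: block_def)
    have "quat_measurable ?G (\<lambda>x. qunit d * entry x j s)"
      using that assms \<beta>(3) by (intro quat_measurable_mult quat_measurable_entry) (auto simp: quat_measurable_def)
    thus ?thesis using quat_measurable_comp \<beta> by (simp add: qrow_def)
  qed
  have "(\<lambda>x. proj_compl (block l i) (map (\<lambda>w. w x) (map (\<lambda>(j, d). qrow d j) (other_index k i))) (qrow 0 i x) \<alpha>)
      \<in> borel_measurable ?G"
    using row assms by (intro borel_measurable_proj_compl) (auto simp: set_other_index)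
  thus ?thesis
    unfolding resid_def others_def by (simp add: comp_def case_prod_unfold)
qed

lemma borel_measurable_resid_sq:
  assumes "i < k" "k \<le> n"
  shows "resid_sq k l i \<in> borel_measurable (gauss (index_set n l))"
  unfolding resid_sq_def[abs_def] inner_on_def
  by (intro borel_measurable_sum borel_measurable_times borel_measurable_resid assms)

lemma quat_measurable_right_inv:
  assumes "i < k" "k \<le> n" "s < l"
  shows "quat_measurable (gauss (index_set n l)) (\<lambda>x. right_inv k l i x s)"
proof -
  note [measurable] = borel_measurable_resid_sq[OF assms(1,2)]
  have [measurable]: "(\<lambda>x. resid k l i x (c, i, s)) \<in> borel_measurable (gauss (index_set n l))" if "c < 4" for c
    using assms that by (intro borel_measurable_resid) (auto simp: block_def)
  show ?thesis by (simp add: quat_measurable_def right_inv_def)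
qed

text \<open>Extensionality of \<open>x\<close> covers rows and columns outside the index set, where
  both sides are \<open>undefined\<close>.\<close>

lemma entry_merge:
  assumes "x \<in> (\<Pi>\<^sub>E \<alpha>\<in>index_set n l. UNIV)" "i \<noteq> j"
  shows "entry (merge (index_set n l - block l j) (block l j) (x, z)) i s = entry x i s"
proof -
  have "merge (index_set n l - block l j) (block l j) (x, z) (c, i, s) = x (c, i, s)" for c
    using assms by (auto simp: merge_def block_def PiE_def extensional_def)
  thus ?thesis by (simp add: entry_def)
qed

text \<open>Residuals involve only the first \<open>k\<close> rows, so they survive resampling of a
  row \<open>j\<close> beyond these.\<close>

lemma resid_merge:
  assumes "x \<in> (\<Pi>\<^sub>E \<alpha>\<in>index_set n l. UNIV)" "i < k" "k \<le> j"
  shows "resid k l i (merge (index_set n l - block l j) (block l j) (x, z)) = resid k l i x"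
proof -
  have row: "qrow d j' (merge (index_set n l - block l j) (block l j) (x, z)) = qrow d j' x" if "j' < k" for d j'
    using entry_merge[OF assms(1), of j' j z] that assms(3) by (simp add: qrow_def)
  from row have "others k i (merge (index_set n l - block l j) (block l j) (x, z)) = others k i x"
    unfolding others_def by (intro map_cong) (auto simp: set_other_index)
  thus ?thesis
    using row[OF assms(2)] unfolding resid_def by simp
qed

text \<open>Resampling row \<open>i\<close> with the other rows fixed makes its residual the
  projection of a fresh Gaussian vector of real dimension \<open>4 * (k + p)\<close> away from
  \<open>4 * (k - 1)\<close> fixed vectors.\<close>

lemma nn_integral_inverse_resid_sq:
  assumes "i < k" "k \<le> n" "1 \<le> p"
  shows "(\<integral>\<^sup>+x. ennreal (1 / resid_sq k (k + p) i x) \<partial>gauss (index_set n (k + p)))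
    \<le> ennreal (1 / (4 * real p + 2))"
proof -
  let ?l = "k + p"
  let ?I = "index_set n ?l" and ?J = "block ?l i"
  interpret prob_space "gauss ?I" by (rule prob_space_gauss)
  note [measurable] = borel_measurable_resid_sq[OF assms(1,2)]
  have "(\<integral>\<^sup>+x. ennreal (1 / resid_sq k ?l i x) \<partial>gauss ?I)
      = (\<integral>\<^sup>+x. (\<integral>\<^sup>+z. ennreal (1 / resid_sq k ?l i (merge (?I - ?J) ?J (x, z))) \<partial>gauss ?J) \<partial>gauss ?I)"
    using assms by (intro nn_integral_gauss_resample block_subset) auto
  also have "\<dots> \<le> (\<integral>\<^sup>+x. ennreal (1 / (4 * real p + 2)) \<partial>gauss ?I)"
  proof (rule nn_integral_mono)
    fix x assume "x \<in> space (gauss ?I)"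
    hence x: "x \<in> (\<Pi>\<^sub>E \<alpha>\<in>?I. UNIV)" by simp
    have "qrow d j (merge (?I - ?J) ?J (x, z)) = qrow d j x" if "j \<noteq> i" for d j z
      using entry_merge[OF x that] by (simp add: qrow_def)
    hence o: "others k i (merge (?I - ?J) ?J (x, z)) = others k i x" for z
      unfolding others_def by (intro map_cong) (auto simp: set_other_index)
    have "resid_sq k ?l i (merge (?I - ?J) ?J (x, z))
        = inner_on ?J (proj_compl ?J (others k i x) z) (proj_compl ?J (others k i x) z)" for z
    proof -
      \<comment> \<open>Only values on the block matter for the projection, and there
        \<open>qrow 0 i\<close> of the merged family is \<open>z\<close>.\<close>
      have r: "resid k ?l i (merge (?I - ?J) ?J (x, z)) \<alpha> = proj_compl ?J (others k i x) z \<alpha>"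
        if "\<alpha> \<in> ?J" for \<alpha>
      proof -
        have "qrow 0 i (merge (?I - ?J) ?J (x, z)) \<beta> = z \<beta>" if "\<beta> \<in> ?J" for \<beta>
          using that by (auto simp: qrow_def block_def merge_def less_4_cases)
        thus ?thesis
          unfolding resid_def o
          by (subst (1 2) proj_compl_matrix[OF finite_block that]) simp
      qed
      show ?thesis unfolding resid_sq_def inner_on_def by (simp add: r)
    qed
    hence "(\<integral>\<^sup>+z. ennreal (1 / resid_sq k ?l i (merge (?I - ?J) ?J (x, z))) \<partial>gauss ?J)
        = (\<integral>\<^sup>+z. ennreal (1 / inner_on ?J (proj_compl ?J (others k i x) z) (proj_compl ?J (others k i x) z)) \<partial>gauss ?J)"
      by simp
    also have "\<dots> \<le> ennreal (1 / (real (card ?J) - real (length (others k i x)) - 2))"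
      using assms by (intro nn_integral_inverse_proj_compl)
        (auto simp: card_block others_def length_other_index)
    \<comment> \<open>The count is \<open>4 * (k + p) - 4 * (k - 1) - 2\<close>; the 2 is the loss
      in Stein's identity.\<close>
    also have "real (card ?J) - real (length (others k i x)) - 2 = 4 * real p + 2"
      using assms by (simp add: card_block others_def length_other_index of_nat_diff)
    finally show "(\<integral>\<^sup>+z. ennreal (1 / resid_sq k ?l i (merge (?I - ?J) ?J (x, z))) \<partial>gauss ?J)
      \<le> ennreal (1 / (4 * real p + 2))" .
  qed
  also have "\<dots> = ennreal (1 / (4 * real p + 2))"
    by (simp only: nn_integral_const emeasure_space_1 mult_1_right)
  finally show ?thesis .
qed

text \<open>Row \<open>j\<close> is independent of the first \<open>k\<close> rows, hence of column
  \<open>i\<close> of the right inverse. The mean over row \<open>j\<close> alone is 4 times the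
  squared norm of that column, that is, 4 divided by \<open>resid_sq\<close>.\<close>

lemma nn_integral_norm_mult_right_inv:
  assumes "i < k" "k \<le> j" "j < n" "1 \<le> p"
  shows "(\<integral>\<^sup>+x. ennreal ((norm (\<Sum>s<k + p. entry x j s * right_inv k (k + p) i x s))\<^sup>2)
      \<partial>gauss (index_set n (k + p))) \<le> ennreal (4 / (4 * real p + 2))"
proof -
  let ?l = "k + p"
  let ?I = "index_set n ?l" and ?J = "block ?l j"
  have "quat_measurable (gauss ?I) (\<lambda>x. \<Sum>s<?l. entry x j s * right_inv k ?l i x s)"
    using assms
    by (intro quat_measurable_sum quat_measurable_mult quat_measurable_entry quat_measurable_right_inv) auto
  note [measurable] = quat_measurable_norm_sq[OF this]
  have "(\<integral>\<^sup>+x. ennreal ((norm (\<Sum>s<?l. entry x j s * right_inv k ?l i x s))\<^sup>2) \<partial>gauss ?I)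
     = (\<integral>\<^sup>+x. (\<integral>\<^sup>+z. ennreal ((norm (\<Sum>s<?l. entry (merge (?I - ?J) ?J (x, z)) j s
          * right_inv k ?l i (merge (?I - ?J) ?J (x, z)) s))\<^sup>2) \<partial>gauss ?J) \<partial>gauss ?I)"
    using assms by (intro nn_integral_gauss_resample block_subset) auto
  also have "\<dots> = (\<integral>\<^sup>+x. (\<integral>\<^sup>+z. ennreal ((norm (\<Sum>s<?l. entry z j s * right_inv k ?l i x s))\<^sup>2) \<partial>gauss ?J) \<partial>gauss ?I)"
  proof (intro nn_integral_cong)
    fix x z assume "x \<in> space (gauss ?I)"
    hence x: "x \<in> (\<Pi>\<^sub>E \<alpha>\<in>?I. UNIV)" by simp
    have "right_inv k ?l i (merge (?I - ?J) ?J (x, z)) s = right_inv k ?l i x s" for s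
      by (simp only: right_inv_def resid_sq_def resid_merge[OF x assms(1,2)])
    moreover have "entry (merge (?I - ?J) ?J (x, z)) j s = entry z j s" if "s < ?l" for s
      using that by (simp add: entry_def merge_def block_def)
    ultimately show "ennreal ((norm (\<Sum>s<?l. entry (merge (?I - ?J) ?J (x, z)) j s
          * right_inv k ?l i (merge (?I - ?J) ?J (x, z)) s))\<^sup>2)
       = ennreal ((norm (\<Sum>s<?l. entry z j s * right_inv k ?l i x s))\<^sup>2)"
      by simp
  qed
  also have "\<dots> = (\<integral>\<^sup>+x. ennreal 4 * ennreal (1 / resid_sq k ?l i x) \<partial>gauss ?I)"
    by (simp only: nn_integral_norm_quat_linear sum_norm_right_inv ennreal_mult'[of 4] zero_le_numeral)
  also have "\<dots> = ennreal 4 * (\<integral>\<^sup>+x. ennreal (1 / resid_sq k ?l i x) \<partial>gauss ?I)"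
    using borel_measurable_resid_sq[OF assms(1), of n ?l] assms by (intro nn_integral_cmult) simp
  also have "\<dots> \<le> ennreal 4 * ennreal (1 / (4 * real p + 2))"
    using assms by (intro mult_left_mono nn_integral_inverse_resid_sq) auto
  also have "\<dots> = ennreal (4 / (4 * real p + 2))"
    by (subst ennreal_mult[symmetric]) auto
  finally show ?thesis .
qed

section \<open>The deterministic error bound\<close>

lemma qcnj_mult: "qcnj (x * y) = qcnj y * qcnj x"
  by (simp add: quat_eq_iff)

lemma qcnj_sum: "qcnj (sum f S) = (\<Sum>x\<in>S. qcnj (f x))"
  by (simp add: quat_eq_iff quat_sum_sel sum_negf)

lemma qcnj_diff: "qcnj (x - y) = qcnj x - qcnj y"
  by (simp add: quat_eq_iff)

lemma qcnj_qcnj [simp]: "qcnj (qcnj x) = x"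
  by (simp add: quat_eq_iff)

lemma index_mult_mat_sum:
  assumes "A \<in> carrier_mat m n" "B \<in> carrier_mat n r" "i < m" "j < r"
  shows "(A * B) $$ (i, j) = (\<Sum>s<n. A $$ (i, s) * B $$ (s, j))"
  using assms by (simp add: scalar_prod_def lessThan_atLeast0)

lemma qadjoint_carrier [simp]: "A \<in> carrier_mat m n \<Longrightarrow> qadjoint A \<in> carrier_mat n m"
  by (simp add: qadjoint_def)

lemma index_qadjoint [simp]:
  "A \<in> carrier_mat m n \<Longrightarrow> i < n \<Longrightarrow> j < m \<Longrightarrow> qadjoint A $$ (i, j) = qcnj (A $$ (j, i))"
  by (simp add: qadjoint_def)

lemma qadjoint_qadjoint: "qadjoint (qadjoint A) = A"
  by (rule eq_matI) (auto simp: qadjoint_def)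

lemma qadjoint_mult:
  assumes "A \<in> carrier_mat m n" "B \<in> carrier_mat n r"
  shows "qadjoint (A * B) = qadjoint B * qadjoint A"
proof (rule eq_matI)
  have AB: "A * B \<in> carrier_mat m r" using assms by simp
  fix i j assume "i < dim_row (qadjoint B * qadjoint A)" "j < dim_col (qadjoint B * qadjoint A)"
  hence ij: "i < r" "j < m" using assms by (auto simp: qadjoint_def)
  show "qadjoint (A * B) $$ (i, j) = (qadjoint B * qadjoint A) $$ (i, j)"
    using assms ij
    by (simp add: index_qadjoint[OF AB] index_mult_mat_sum[OF assms]
      index_mult_mat_sum[OF qadjoint_carrier[OF assms(2)] qadjoint_carrier[OF assms(1)]]
      qcnj_sum qcnj_mult del: index_mult_mat)
qed (use assms in \<open>auto simp: qadjoint_def\<close>)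

lemma qadjoint_minus:
  assumes "A \<in> carrier_mat m n" "B \<in> carrier_mat m n"
  shows "qadjoint (A - B) = qadjoint A - qadjoint B"
  using assms by (intro eq_matI) (auto simp: qadjoint_def qcnj_diff)

definition col_sq :: "quat mat \<Rightarrow> nat \<Rightarrow> real" where
  "col_sq X j = (\<Sum>i<dim_row X. (norm (X $$ (i, j)))\<^sup>2)"

lemma frobenius_norm_sq: "(frobenius_norm X)\<^sup>2 = (\<Sum>j<dim_col X. col_sq X j)"
proof -
  have "(frobenius_norm X)\<^sup>2 = (\<Sum>i<dim_row X. \<Sum>j<dim_col X. (norm (X $$ (i, j)))\<^sup>2)"
    unfolding frobenius_norm_def by (intro real_sqrt_pow2 sum_nonneg) auto
  also have "\<dots> = (\<Sum>j<dim_col X. col_sq X j)"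
    unfolding col_sq_def by (rule sum.swap)
  finally show ?thesis .
qed

lemma frobenius_norm_qadjoint: "frobenius_norm (qadjoint X) = frobenius_norm X"
  unfolding frobenius_norm_def by (subst sum.swap) (simp add: qadjoint_def)

lemma frobenius_norm_minus_commute:
  assumes "X \<in> carrier_mat m n" "Y \<in> carrier_mat m n"
  shows "frobenius_norm (X - Y) = frobenius_norm (Y - X)"
  using assms unfolding frobenius_norm_def
  by (intro arg_cong[of _ _ sqrt] sum.cong) (auto simp: norm_minus_commute)

lemma col_sq_eq:
  assumes "X \<in> carrier_mat m n" "j < n"
  shows "col_sq X j = qre ((qadjoint X * X) $$ (j, j))"
  using assms
  by (simp add: col_sq_def index_mult_mat_sum[OF qadjoint_carrier[OF assms(1)] assms(1)]
      quat_sum_sel qcnj_mult_self del: index_mult_mat times_quat_sel)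

text \<open>Squared column norms form the diagonal of the Gram matrix, in which \<open>W\<close>
  cancels.\<close>

lemma col_sq_isometry:
  assumes W: "W \<in> carrier_mat m r" "qadjoint W * W = 1\<^sub>m r" and X: "X \<in> carrier_mat r n" and j: "j < n"
  shows "col_sq (W * X) j = col_sq X j"
proof -
  have "qadjoint (W * X) * (W * X) = qadjoint X * qadjoint W * (W * X)"
    by (simp add: qadjoint_mult[OF W(1) X])
  also have "\<dots> = qadjoint X * (qadjoint W * (W * X))"
    using W(1) X by (intro assoc_mult_mat[of _ n r _ m _ n]) auto
  also have "qadjoint W * (W * X) = qadjoint W * W * X"
    using W(1) X by (intro assoc_mult_mat[symmetric, of _ r m _ r _ n]) auto
  also have "\<dots> = X" using W X by simp
  finally show ?thesis
    using W(1) X j by (simp add: col_sq_eq[of "W * X" m n] col_sq_eq[of X r n])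
qed

section \<open>Projection onto the complement of the range of an orthonormal basis\<close>

definition resid_mat :: "quat mat \<Rightarrow> quat mat \<Rightarrow> quat mat" where
  "resid_mat Q X = X - Q * qadjoint Q * X"

context
  fixes Q :: "quat mat" and m l :: nat
  assumes Q: "Q \<in> carrier_mat m l" and orth: "qadjoint Q * Q = 1\<^sub>m l"
begin

lemma resid_mat_carrier: "X \<in> carrier_mat m n \<Longrightarrow> resid_mat Q X \<in> carrier_mat m n"
  using Q by (auto simp: resid_mat_def)

lemma resid_mat_mult:
  assumes "X \<in> carrier_mat m n" "Z \<in> carrier_mat n r"
  shows "resid_mat Q (X * Z) = resid_mat Q X * Z"
proof -
  have P: "Q * qadjoint Q \<in> carrier_mat m m" using Q by simp
  show ?thesis
    unfolding resid_mat_def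
    using minus_mult_distrib_mat[of X m n "Q * qadjoint Q * X" Z r] assms P
    by (simp add: assoc_mult_mat[OF P assms])
qed

text \<open>Pythagoras: with \<open>Y = qadjoint Q * X\<close>, both cross terms in the Gram matrix
  of \<open>X - Q * Y\<close> equal \<open>qadjoint Y * Y\<close>, and \<open>Q\<close> preserves
  column norms. On the diagonal this leaves the Gram matrix of \<open>X\<close> minus that of
  \<open>Y\<close>.\<close>

lemma col_sq_resid_mat_le:
  assumes X: "X \<in> carrier_mat m n" and j: "j < n"
  shows "col_sq (resid_mat Q X) j \<le> col_sq X j"
proof -
  define Y where "Y = qadjoint Q * X"
  have Y: "Y \<in> carrier_mat l n"
    unfolding Y_def by (rule mult_carrier_mat[OF qadjoint_carrier[OF Q] X])
  have Y': "qadjoint Y = qadjoint X * Q"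
    unfolding Y_def using qadjoint_mult[OF qadjoint_carrier[OF Q] X] by (simp add: qadjoint_qadjoint)
  have QY: "Q * Y \<in> carrier_mat m n" using Q Y by simp
  have D: "X - Q * Y \<in> carrier_mat m n" using QY by (rule minus_carrier_mat)
  have r: "resid_mat Q X = X - Q * Y"
    unfolding resid_mat_def Y_def using assoc_mult_mat[OF Q qadjoint_carrier[OF Q] X] by simp
  have 1: "qadjoint X * (Q * Y) = qadjoint Y * Y"
    unfolding Y' using assoc_mult_mat[OF qadjoint_carrier[OF X] Q Y] by simp
  have 2: "qadjoint (Q * Y) * X = qadjoint Y * Y"
    unfolding qadjoint_mult[OF Q Y]
    using assoc_mult_mat[OF qadjoint_carrier[OF Y] qadjoint_carrier[OF Q] X] by (simp add: Y_def)
  have "col_sq (X - Q * Y) j = qre ((qadjoint (X - Q * Y) * (X - Q * Y)) $$ (j, j))"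
    by (rule col_sq_eq[OF D j])
  also have "qadjoint (X - Q * Y) * (X - Q * Y)
      = qadjoint X * (X - Q * Y) - qadjoint (Q * Y) * (X - Q * Y)"
    unfolding qadjoint_minus[OF X QY]
    using X QY D by (intro minus_mult_distrib_mat[of _ n m _ _ n]) auto
  also have "qadjoint X * (X - Q * Y) = qadjoint X * X - qadjoint Y * Y"
    unfolding 1[symmetric] using X QY by (intro mult_minus_distrib_mat[of _ n m _ n]) auto
  also have "qadjoint (Q * Y) * (X - Q * Y) = qadjoint Y * Y - qadjoint (Q * Y) * (Q * Y)"
    unfolding 2[symmetric] using X QY by (intro mult_minus_distrib_mat[of _ n m _ n]) auto
  also have "qre ((qadjoint X * X - qadjoint Y * Y - (qadjoint Y * Y - qadjoint (Q * Y) * (Q * Y))) $$ (j, j))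
      = col_sq X j - col_sq Y j - (col_sq Y j - col_sq (Q * Y) j)"
  proof -
    have c: "qadjoint Z * Z \<in> carrier_mat n n" if "Z \<in> carrier_mat r n" for Z r
      by (rule mult_carrier_mat[OF qadjoint_carrier[OF that] that])
    show ?thesis
      using c[OF X, THEN carrier_matD(1)] c[OF X, THEN carrier_matD(2)]
        c[OF Y, THEN carrier_matD(1)] c[OF Y, THEN carrier_matD(2)]
        c[OF QY, THEN carrier_matD(1)] c[OF QY, THEN carrier_matD(2)] j
      by (simp add: col_sq_eq[OF X j] col_sq_eq[OF Y j] col_sq_eq[OF QY j] del: index_mult_mat)
  qed
  also have "\<dots> = col_sq X j - col_sq Y j"
    by (simp add: col_sq_isometry[OF Q orth Y j])
  also have "\<dots> \<le> col_sq X j"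
    by (simp add: col_sq_def sum_nonneg)
  finally show ?thesis by (simp add: r)
qed

text \<open>Each column of \<open>Y\<close> has the form \<open>Q *\<^sub>v z\<close>, and
  \<open>Q * qadjoint Q\<close> fixes it since \<open>qadjoint Q * Q\<close> is the
  identity.\<close>

lemma resid_mat_eq_0:
  assumes Y: "Y \<in> carrier_mat m r" and range: "col_range Y \<subseteq> col_range Q"
  shows "resid_mat Q Y = 0\<^sub>m m r"
proof -
  have P: "Q * qadjoint Q \<in> carrier_mat m m" using Q by simp
  have "Q * qadjoint Q * Y = Y"
  proof (rule mat_col_eqI)
    fix j assume "j < dim_col Y"
    hence j: "j < r" using Y by simp
    have "col Y j = Y *\<^sub>v unit_vec r j"
      using Y j by (intro eq_vecI) auto
    moreover have "unit_vec r j \<in> carrier_vec (dim_col Y)"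
      using Y by simp
    ultimately have "col Y j \<in> col_range Y"
      unfolding col_range_def by blast
    hence "col Y j \<in> col_range Q"
      using range by blast
    then obtain z where z: "z \<in> carrier_vec l" "col Y j = Q *\<^sub>v z"
      using Q by (auto simp: col_range_def)
    have "col (Q * qadjoint Q * Y) j = Q * qadjoint Q *\<^sub>v col Y j"
      using P Y j by (intro col_mult2[of _ m m _ r]) auto
    also have "\<dots> = (Q * qadjoint Q * Q) *\<^sub>v z"
      using assoc_mult_mat_vec[OF P Q z(1)] z(2) by simp
    also have "Q * qadjoint Q * Q = Q"
      using assoc_mult_mat[OF Q qadjoint_carrier[OF Q] Q] orth Q by simp
    finally show "col (Q * qadjoint Q * Y) j = col Y j" using z by simp
  qed (use Q Y in \<open>auto simp: qadjoint_def\<close>)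
  thus ?thesis using Y by (simp add: resid_mat_def)
qed

end

text \<open>Any \<open>R\<close> inverting the first \<open>k\<close> rows of
  \<open>qadjoint V * Om\<close> from the right will do. It expresses the first \<open>k\<close>
  columns of the residual \<open>C\<close> through the others, while each remaining column is
  controlled by its singular value alone.\<close>

lemma rqsvd_error_sq_le:
  assumes mn: "n \<le> m" and A: "A \<in> carrier_mat m n" and svd: "is_qsvd m n A U \<sigma> V" and k: "k \<le> n"
    and Om: "Om \<in> carrier_mat n l" and qr: "is_qr_basis (A * Om) Q"
    and R: "R \<in> carrier_mat l k"
    and GR: "\<And>i j. i < k \<Longrightarrow> j < k \<Longrightarrow> (qadjoint V * Om * R) $$ (i, j) = of_bool (i = j)"
  shows "(frobenius_norm (rqsvd_approx A Q - A))\<^sup>2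
    \<le> (\<Sum>j=k..<n. (\<sigma> j)\<^sup>2 * (1 + (\<Sum>i<k. (norm ((qadjoint V * Om * R) $$ (j, i)))\<^sup>2)))"
proof -
  define S where "S = rect_diag m n \<sigma>"
  have S: "S \<in> carrier_mat m n" by (simp add: S_def rect_diag_def)
  have U: "U \<in> carrier_mat m m" "qadjoint U * U = 1\<^sub>m m"
    and V: "V \<in> carrier_mat n n" "qadjoint V * V = 1\<^sub>m n" "V * qadjoint V = 1\<^sub>m n"
    and AS: "A = U * S * qadjoint V"
    using svd by (auto simp: is_qsvd_def qunitary_def S_def)
  have AO: "A * Om \<in> carrier_mat m l" using A Om by simp
  have Q: "Q \<in> carrier_mat m l" "qadjoint Q * Q = 1\<^sub>m l" "col_range (A * Om) \<subseteq> col_range Q"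
    using qr A Om by (auto simp: is_qr_basis_def)
  have US: "U * S \<in> carrier_mat m n" using U S by simp
  define C where "C = resid_mat Q (U * S)"
  have C: "C \<in> carrier_mat m n"
    unfolding C_def by (rule resid_mat_carrier[OF Q(1,2) US])
  define G where "G = qadjoint V * Om"
  have G: "G \<in> carrier_mat n l"
    unfolding G_def by (rule mult_carrier_mat[OF qadjoint_carrier[OF V(1)] Om])
  define H where "H = G * R"
  have H: "H \<in> carrier_mat n k" using G R by (simp add: H_def)
  \<comment> \<open>\<open>C * G\<close> is the residual of \<open>A * Om\<close>, whose columns lie
    in the range of \<open>Q\<close>.\<close>
  have "C * G = resid_mat Q (U * S * G)"
    unfolding C_def by (rule resid_mat_mult[OF Q(1,2) US G, symmetric])
  also have "U * S * G = A * Om"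
    unfolding G_def AS using assoc_mult_mat[OF US qadjoint_carrier[OF V(1)] Om] by simp
  also have "resid_mat Q (A * Om) = 0\<^sub>m m l"
    by (rule resid_mat_eq_0[OF Q(1,2) AO Q(3)])
  finally have CG: "C * G = 0\<^sub>m m l" .
  have CH: "C * H = 0\<^sub>m m k"
    unfolding H_def using assoc_mult_mat[OF C G R] CG R by simp
  \<comment> \<open>\<open>H\<close> has the identity as its first \<open>k\<close> rows and
    \<open>H'\<close> keeps only the rows below, so \<open>C * H = 0\<close> says that column
    \<open>i\<close> of \<open>C\<close> is minus column \<open>i\<close> of
    \<open>C * H'\<close>.\<close>
  define H' where "H' = mat n k (\<lambda>(j, i). if j < k then 0 else H $$ (j, i))"
  have H': "H' \<in> carrier_mat n k" by (simp add: H'_def)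
  have col_C: "col_sq C i = col_sq (C * H') i" if i: "i < k" for i
  proof -
    have "C $$ (a, i) = - (C * H') $$ (a, i)" if a: "a < m" for a
    proof -
      have "0 = (C * H) $$ (a, i)" using CH a i by simp
      also have "\<dots> = (\<Sum>s<n. C $$ (a, s) * H $$ (s, i))"
        by (rule index_mult_mat_sum[OF C H a i])
      also have "\<dots> = (\<Sum>s<n. C $$ (a, s) * of_bool (s = i) + C $$ (a, s) * H' $$ (s, i))"
        using GR i by (intro sum.cong refl) (auto simp: H'_def H_def G_def simp del: index_mult_mat(1))
      also have "\<dots> = C $$ (a, i) + (\<Sum>s<n. C $$ (a, s) * H' $$ (s, i))"
      proof -
        have "(\<Sum>s<n. C $$ (a, s) * of_bool (s = i)) = (\<Sum>s<n. if s = i then C $$ (a, i) else 0)"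
          by (intro sum.cong) auto
        thus ?thesis using i k by (simp add: sum.distrib)
      qed
      also have "(\<Sum>s<n. C $$ (a, s) * H' $$ (s, i)) = (C * H') $$ (a, i)"
        by (rule index_mult_mat_sum[OF C H' a i, symmetric])
      finally show ?thesis by (simp add: eq_neg_iff_add_eq_0)
    qed
    thus ?thesis
      unfolding col_sq_def using C H' by (auto intro!: sum.cong simp del: index_mult_mat(1))
  qed
  have S_H': "col_sq (S * H') i = (\<Sum>j=k..<n. (\<sigma> j)\<^sup>2 * (norm (H $$ (j, i)))\<^sup>2)" if i: "i < k" for i
  proof -
    have e: "(S * H') $$ (a, i) = (if a < n then of_real (\<sigma> a) * H' $$ (a, i) else 0)" if a: "a < m" for a
    proof -
      have "(S * H') $$ (a, i) = (\<Sum>s<n. S $$ (a, s) * H' $$ (s, i))"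
        by (rule index_mult_mat_sum[OF S H' a i])
      also have "\<dots> = (\<Sum>s<n. if s = a then of_real (\<sigma> a) * H' $$ (a, i) else 0)"
        using a by (intro sum.cong refl) (auto simp: S_def rect_diag_def)
      finally show ?thesis by (simp add: sum.delta)
    qed
    have "col_sq (S * H') i = (\<Sum>a<m. if a < n then (\<sigma> a)\<^sup>2 * (norm (H' $$ (a, i)))\<^sup>2 else 0)"
      unfolding col_sq_def using S H'
      by (auto intro!: sum.cong simp: e norm_mult power_mult_distrib simp del: index_mult_mat(1))
    also have "\<dots> = (\<Sum>a\<in>{k..<n}. (\<sigma> a)\<^sup>2 * (norm (H $$ (a, i)))\<^sup>2)"
      using mn i by (intro sum.mono_neutral_cong_right) (auto simp: H'_def)
    finally show ?thesis .
  qed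
  \<comment> \<open>\<open>C * H'\<close> is again a residual, so the contraction and the isometry
    \<open>U\<close> reduce the bound to \<open>S * H'\<close>.\<close>
  have low: "col_sq C i \<le> (\<Sum>j=k..<n. (\<sigma> j)\<^sup>2 * (norm (H $$ (j, i)))\<^sup>2)" if i: "i < k" for i
  proof -
    have "C * H' = resid_mat Q (U * S * H')"
      unfolding C_def by (rule resid_mat_mult[OF Q(1,2) US H', symmetric])
    hence "col_sq C i \<le> col_sq (U * S * H') i"
      using col_sq_resid_mat_le[OF Q(1,2), of "U * S * H'" k i] col_C i US H' by simp
    also have "\<dots> = col_sq (S * H') i"
      using assoc_mult_mat[OF U(1) S H'] col_sq_isometry[OF U, of "S * H'" k i] S H' i by simp
    finally show ?thesis by (simp add: S_H'[OF i])
  qed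
  have high: "col_sq C j \<le> (\<sigma> j)\<^sup>2" if j: "j < n" for j
  proof -
    have "col_sq C j \<le> col_sq (U * S) j"
      unfolding C_def by (rule col_sq_resid_mat_le[OF Q(1,2) US j])
    also have "\<dots> = col_sq S j"
      by (rule col_sq_isometry[OF U S j])
    also have "\<dots> = (\<Sum>a<m. if a = j then (\<sigma> j)\<^sup>2 else 0)"
      unfolding col_sq_def using j by (intro sum.cong) (auto simp: S_def rect_diag_def)
    also have "\<dots> = (\<sigma> j)\<^sup>2" using j mn by (simp add: sum.delta)
    finally show ?thesis .
  qed
  \<comment> \<open>Column norms are unchanged by isometries on the left; taking adjoints moves the
    unitary \<open>V\<close> to that side, where it drops out.\<close>
  have "frobenius_norm (rqsvd_approx A Q - A) = frobenius_norm (resid_mat Q A)"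
    unfolding rqsvd_approx_def resid_mat_def using A Q by (intro frobenius_norm_minus_commute) auto
  also have "resid_mat Q A = C * qadjoint V"
    unfolding C_def AS by (rule resid_mat_mult[OF Q(1,2) US qadjoint_carrier[OF V(1)]])
  also have "frobenius_norm \<dots> = frobenius_norm (qadjoint (C * qadjoint V))"
    by (rule frobenius_norm_qadjoint[symmetric])
  also have "qadjoint (C * qadjoint V) = V * qadjoint C"
    using qadjoint_mult[OF C qadjoint_carrier[OF V(1)]] by (simp add: qadjoint_qadjoint)
  finally have "(frobenius_norm (rqsvd_approx A Q - A))\<^sup>2 = (\<Sum>j<m. col_sq (V * qadjoint C) j)"
    using V C by (simp add: frobenius_norm_sq qadjoint_def)
  also have "\<dots> = (\<Sum>j<m. col_sq (qadjoint C) j)"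
    using C by (intro sum.cong refl col_sq_isometry[OF V(1,2)]) auto
  also have "\<dots> = (frobenius_norm (qadjoint C))\<^sup>2"
    using C by (simp add: frobenius_norm_sq qadjoint_def)
  also have "\<dots> = (\<Sum>j<n. col_sq C j)"
    using C by (simp add: frobenius_norm_qadjoint frobenius_norm_sq)
  also have "\<dots> = (\<Sum>i<k. col_sq C i) + (\<Sum>j=k..<n. col_sq C j)"
    using k sum.atLeastLessThan_concat[of 0 k n "col_sq C"] by (simp add: lessThan_atLeast0)
  also have "\<dots> \<le> (\<Sum>i<k. \<Sum>j=k..<n. (\<sigma> j)\<^sup>2 * (norm (H $$ (j, i)))\<^sup>2) + (\<Sum>j=k..<n. (\<sigma> j)\<^sup>2)"
    using low high by (intro add_mono sum_mono) auto
  also have "\<dots> = (\<Sum>j=k..<n. (\<sigma> j)\<^sup>2 * (1 + (\<Sum>i<k. (norm (H $$ (j, i)))\<^sup>2)))"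
    by (subst sum.swap) (simp add: distrib_left sum.distrib sum_distrib_left add.commute)
  finally show ?thesis unfolding H_def G_def .
qed

section \<open>Unitary invariance and the expected error\<close>

definition coords :: "nat \<Rightarrow> nat \<Rightarrow> quat mat \<Rightarrow> nat \<times> nat \<times> nat \<Rightarrow> real" where
  "coords n l X = (\<lambda>(c, i, s)\<in>index_set n l. quat_comp c (X $$ (i, s)))"

definition of_coords :: "nat \<Rightarrow> nat \<Rightarrow> (nat \<times> nat \<times> nat \<Rightarrow> real) \<Rightarrow> quat mat" where
  "of_coords n l x = mat n l (\<lambda>(i, s). entry x i s)"

lemma of_coords_carrier [simp]: "of_coords n l x \<in> carrier_mat n l"
  by (simp add: of_coords_def)

lemma coords_in_PiE [simp]: "coords n l X \<in> (\<Pi>\<^sub>E \<alpha>\<in>index_set n l. UNIV)"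
  by (auto simp: coords_def)

lemma entry_coords: "i < n \<Longrightarrow> s < l \<Longrightarrow> entry (coords n l X) i s = X $$ (i, s)"
  by (simp add: quat_eq_iff coords_def index_set_def)

lemma of_coords_coords: "X \<in> carrier_mat n l \<Longrightarrow> of_coords n l (coords n l X) = X"
  by (intro eq_matI) (auto simp: of_coords_def entry_coords)

lemma coords_of_coords:
  assumes "x \<in> (\<Pi>\<^sub>E \<alpha>\<in>index_set n l. UNIV)"
  shows "coords n l (of_coords n l x) = x"
proof (rule extensionalityI[of _ "index_set n l"])
  fix \<alpha> assume "\<alpha> \<in> index_set n l"
  thus "coords n l (of_coords n l x) \<alpha> = x \<alpha>"
    by (auto simp: coords_def of_coords_def index_set_def less_4_cases)
qed (use assms in \<open>auto simp: coords_def PiE_def\<close>)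

lemma sum_index_set: "(\<Sum>\<alpha>\<in>index_set n l. f \<alpha>) = (\<Sum>s<l. \<Sum>i<n. \<Sum>c<4. f (c, i, s))"
proof -
  have "(\<Sum>\<alpha>\<in>index_set n l. f \<alpha>) = (\<Sum>c<4. \<Sum>i<n. \<Sum>s<l. f (c, i, s))"
    unfolding index_set_def by (simp add: sum.cartesian_product case_prod_unfold)
  also have "\<dots> = (\<Sum>i<n. \<Sum>c<4. \<Sum>s<l. f (c, i, s))" by (rule sum.swap)
  also have "\<dots> = (\<Sum>i<n. \<Sum>s<l. \<Sum>c<4. f (c, i, s))" by (intro sum.cong refl sum.swap)
  also have "\<dots> = (\<Sum>s<l. \<Sum>i<n. \<Sum>c<4. f (c, i, s))" by (rule sum.swap)
  finally show ?thesis .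
qed

lemma sum_coords_sq:
  assumes "X \<in> carrier_mat n l"
  shows "(\<Sum>\<alpha>\<in>index_set n l. (coords n l X \<alpha>)\<^sup>2) = (\<Sum>s<l. col_sq X s)"
  unfolding sum_index_set col_sq_def
  using assms by (intro sum.cong refl) (auto simp: coords_def index_set_def norm_quat_sq sum_lessThan_4)

lemma measurable_coords_mult:
  assumes W: "W \<in> carrier_mat n n"
  shows "(\<lambda>x. coords n l (W * of_coords n l x)) \<in> measurable (gauss (index_set n l)) (gauss (index_set n l))"
proof -
  let ?I = "index_set n l"
  have "(\<lambda>x. coords n l (W * of_coords n l x)) \<in> measurable (gauss ?I) (\<Pi>\<^sub>M i\<in>?I. borel)"
    unfolding coords_def
  proof (rule measurable_restrict)
    fix \<alpha> assume "\<alpha> \<in> ?I"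
    then obtain c i s where \<alpha>: "\<alpha> = (c, i, s)" "c < 4" "i < n" "s < l"
      by (auto simp: index_set_def)
    have "quat_measurable (gauss ?I) (\<lambda>x. \<Sum>a<n. W $$ (i, a) * entry x a s)"
      using \<alpha> by (intro quat_measurable_sum quat_measurable_mult quat_measurable_entry)
        (auto simp: quat_measurable_def)
    moreover have "(W * of_coords n l x) $$ (i, s) = (\<Sum>a<n. W $$ (i, a) * entry x a s)" for x
      using index_mult_mat_sum[OF W of_coords_carrier \<alpha>(3,4)] \<alpha> by (simp add: of_coords_def)
    ultimately show "(\<lambda>x. case \<alpha> of (c, i, s) \<Rightarrow> quat_comp c ((W * of_coords n l x) $$ (i, s)))
        \<in> borel_measurable (gauss ?I)"
      using \<alpha> by (simp add: quat_measurable_comp del: index_mult_mat)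
  qed
  thus ?thesis
    using measurable_cong_sets[OF refl sets_gauss] by auto
qed

text \<open>Left multiplication by \<open>W\<close> is additive on coordinates, keeps the squared
  norm of each column, and is onto because \<open>qadjoint W\<close> inverts it; isometry invariance
  of the Gaussian measure then applies.\<close>

lemma nn_integral_gauss_unitary:
  assumes W: "qunitary n W" and f: "f \<in> borel_measurable (gauss (index_set n l))"
  shows "(\<integral>\<^sup>+x. f (coords n l (W * of_coords n l x)) \<partial>gauss (index_set n l)) = (\<integral>\<^sup>+x. f x \<partial>gauss (index_set n l))"
proof (rule nn_integral_gauss_isometry)
  let ?I = "index_set n l"
  have Wc: "W \<in> carrier_mat n n" "qadjoint W * W = 1\<^sub>m n" "W * qadjoint W = 1\<^sub>m n"
    using W by (auto simp: qunitary_def)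
  have WX: "(W * of_coords n l x) $$ (i, s) = (\<Sum>a<n. W $$ (i, a) * entry x a s)" if "i < n" "s < l" for x i s
    using index_mult_mat_sum[OF Wc(1) of_coords_carrier that] that by (simp add: of_coords_def)
  have WXc: "W * of_coords n l x \<in> carrier_mat n l" for x
    by (rule mult_carrier_mat[OF Wc(1) of_coords_carrier])
  show "finite ?I" by simp
  show "(\<lambda>x. coords n l (W * of_coords n l x)) \<in> measurable (\<Pi>\<^sub>M i\<in>?I. borel) (\<Pi>\<^sub>M i\<in>?I. borel)"
    using measurable_coords_mult[OF Wc(1)] measurable_cong_sets[OF sets_gauss sets_gauss] by auto
  show "coords n l (W * of_coords n l (\<lambda>i\<in>?I. x i + y i)) \<alpha>
      = coords n l (W * of_coords n l x) \<alpha> + coords n l (W * of_coords n l y) \<alpha>" if "\<alpha> \<in> ?I" for x y \<alpha>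
  proof -
    obtain c i s where \<alpha>: "\<alpha> = (c, i, s)" "c < 4" "i < n" "s < l"
      using \<open>\<alpha> \<in> ?I\<close> by (auto simp: index_set_def)
    have "entry (\<lambda>i\<in>?I. x i + y i) a s = entry x a s + entry y a s" if "a < n" for a
      using that \<alpha> by (simp add: quat_eq_iff index_set_def)
    hence "(W * of_coords n l (\<lambda>i\<in>?I. x i + y i)) $$ (i, s)
        = (W * of_coords n l x) $$ (i, s) + (W * of_coords n l y) $$ (i, s)"
      using \<alpha> by (simp add: WX distrib_left sum.distrib del: index_mult_mat)
    thus ?thesis
      using that \<alpha> by (auto simp: coords_def less_4_cases simp del: index_mult_mat)
  qed
  show "(\<Sum>i\<in>?I. (coords n l (W * of_coords n l x) i)\<^sup>2) = (\<Sum>i\<in>?I. (x i)\<^sup>2)"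
    if x: "x \<in> (\<Pi>\<^sub>E \<alpha>\<in>?I. UNIV)" for x
  proof -
    have "(\<Sum>i\<in>?I. (coords n l (W * of_coords n l x) i)\<^sup>2) = (\<Sum>s<l. col_sq (W * of_coords n l x) s)"
      by (rule sum_coords_sq[OF WXc])
    also have "\<dots> = (\<Sum>s<l. col_sq (of_coords n l x) s)"
      by (intro sum.cong refl col_sq_isometry[OF Wc(1,2) of_coords_carrier]) auto
    also have "\<dots> = (\<Sum>i\<in>?I. (coords n l (of_coords n l x) i)\<^sup>2)"
      by (rule sum_coords_sq[symmetric]) simp
    finally show ?thesis by (simp add: coords_of_coords[OF x])
  qed
  show "\<exists>x\<in>\<Pi>\<^sub>E \<alpha>\<in>?I. UNIV. coords n l (W * of_coords n l x) = y" if y: "y \<in> (\<Pi>\<^sub>E \<alpha>\<in>?I. UNIV)" for y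
  proof (rule bexI)
    let ?Y = "of_coords n l y"
    have "qadjoint W * ?Y \<in> carrier_mat n l"
      by (rule mult_carrier_mat[OF qadjoint_carrier[OF Wc(1)] of_coords_carrier])
    hence "W * of_coords n l (coords n l (qadjoint W * ?Y)) = W * (qadjoint W * ?Y)"
      by (simp add: of_coords_coords)
    also have "\<dots> = ?Y"
      using assoc_mult_mat[OF Wc(1) qadjoint_carrier[OF Wc(1)] of_coords_carrier, of l y] Wc(3)
        left_mult_one_mat[OF of_coords_carrier, of n l y] by simp
    finally show "coords n l (W * of_coords n l (coords n l (qadjoint W * ?Y))) = y"
      by (simp add: coords_of_coords[OF y])
  qed simp
  show "f \<in> borel_measurable (\<Pi>\<^sub>M i\<in>?I. borel)"
    using f measurable_cong_sets[OF sets_gauss refl] by auto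
qed

text \<open>Independence turns the joint law of the real components into the product of their laws,
  each of them standard normal by assumption.\<close>

lemma distr_coords_random_test_matrix:
  assumes "quat_random_test_matrix M n l \<Omega>" "0 < n" "0 < l"
  shows "(\<lambda>\<omega>. coords n l (\<Omega> \<omega>)) \<in> measurable M (gauss (index_set n l))"
    and "distr M (gauss (index_set n l)) (\<lambda>\<omega>. coords n l (\<Omega> \<omega>)) = gauss (index_set n l)"
proof -
  let ?I = "index_set n l"
  let ?X = "\<lambda>(c, i, j) \<omega>. quat_comp c (\<Omega> \<omega> $$ (i, j))"
  interpret prob_space M using assms(1) by (simp add: quat_random_test_matrix_def)
  have D: "distributed M lborel (?X \<alpha>) std_normal_density" if "\<alpha> \<in> ?I" for \<alpha>
    using that assms(1) by (auto simp: index_set_def quat_random_test_matrix_def)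
  have indep: "indep_vars (\<lambda>_. borel) ?X ?I"
    using assms(1) by (simp add: index_set_def quat_random_test_matrix_def)
  have rv: "random_variable borel (?X \<alpha>)" if "\<alpha> \<in> ?I" for \<alpha>
    using distributed_measurable[OF D[OF that]] by simp
  \<comment> \<open>The characterization of independence by the product law is applied to a nonempty
    family.\<close>
  have "(0, 0, 0) \<in> ?I"
    using assms(2,3) by (simp add: index_set_def)
  hence ne: "?I \<noteq> {}" by blast
  have eq: "coords n l (\<Omega> \<omega>) = (\<lambda>\<alpha>\<in>?I. ?X \<alpha> \<omega>)" for \<omega>
    by (auto simp: coords_def fun_eq_iff)
  have m: "(\<lambda>\<omega>. \<lambda>\<alpha>\<in>?I. ?X \<alpha> \<omega>) \<in> measurable M (\<Pi>\<^sub>M \<alpha>\<in>?I. borel)"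
    by (intro measurable_restrict rv)
  thus "(\<lambda>\<omega>. coords n l (\<Omega> \<omega>)) \<in> measurable M (gauss ?I)"
    unfolding eq using measurable_cong_sets[OF refl sets_gauss] by auto
  have "distr M (gauss ?I) (\<lambda>\<omega>. coords n l (\<Omega> \<omega>)) = distr M (\<Pi>\<^sub>M \<alpha>\<in>?I. borel) (\<lambda>\<omega>. \<lambda>\<alpha>\<in>?I. ?X \<alpha> \<omega>)"
    unfolding eq by (intro distr_cong sets_gauss) auto
  also have "\<dots> = (\<Pi>\<^sub>M \<alpha>\<in>?I. distr M borel (?X \<alpha>))"
    using indep indep_vars_iff_distr_eq_PiM'[OF ne rv] by simp
  also have "\<dots> = (\<Pi>\<^sub>M \<alpha>\<in>?I. std_normal_distribution)"
  proof (intro PiM_cong refl)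
    fix \<alpha> assume "\<alpha> \<in> ?I"
    from distributed_distr_eq_density[OF D[OF this]]
    show "distr M borel (?X \<alpha>) = std_normal_distribution"
      by (subst distr_cong[of M M borel lborel "?X \<alpha>" "?X \<alpha>"]) auto
  qed
  finally show "distr M (gauss ?I) (\<lambda>\<omega>. coords n l (\<Omega> \<omega>)) = gauss ?I"
    by (simp add: gauss_def)
qed

text \<open>The first \<open>k\<close> rows of \<open>qadjoint V * Om\<close> form
  \<open>qadjoint (first_cols k V) * Om\<close>, so a left relation \<open>\<xi>\<close> among them
  is a row matrix annihilating that product.\<close>

lemma full_row_rank_left_cancel:
  assumes V: "V \<in> carrier_mat n n" and Om: "Om \<in> carrier_mat n l" and k: "k \<le> n"
    and rank: "full_row_rank (qadjoint (first_cols k V) * Om)"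
    and \<xi>: "\<And>s. s < l \<Longrightarrow> (\<Sum>j<k. \<xi> j * (qadjoint V * Om) $$ (j, s)) = 0"
    and j: "j < k"
  shows "\<xi> j = 0"
proof -
  define x where "x = mat 1 k (\<lambda>(_, j). \<xi> j)"
  define B where "B = qadjoint (first_cols k V) * Om"
  have V1: "first_cols k V \<in> carrier_mat n k"
    using V by (simp add: first_cols_def)
  have B: "B \<in> carrier_mat k l"
    unfolding B_def by (rule mult_carrier_mat[OF qadjoint_carrier[OF V1] Om])
  have x: "x \<in> carrier_mat 1 k" by (simp add: x_def)
  have Bj: "B $$ (j, s) = (qadjoint V * Om) $$ (j, s)" if "j < k" "s < l" for j s
  proof -
    have j: "j < n" using that k by simp
    have "B $$ (j, s) = (\<Sum>a<n. qadjoint (first_cols k V) $$ (j, a) * Om $$ (a, s))"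
      unfolding B_def by (rule index_mult_mat_sum[OF qadjoint_carrier[OF V1] Om that])
    also have "\<dots> = (\<Sum>a<n. qadjoint V $$ (j, a) * Om $$ (a, s))"
      using V that j
      by (intro sum.cong refl) (simp add: index_qadjoint[OF V1] index_qadjoint[OF V], simp add: first_cols_def)
    also have "\<dots> = (qadjoint V * Om) $$ (j, s)"
      by (rule index_mult_mat_sum[OF qadjoint_carrier[OF V] Om j that(2), symmetric])
    finally show ?thesis .
  qed
  have "x * B = 0\<^sub>m 1 l"
  proof (rule eq_matI)
    fix i s assume "i < dim_row (0\<^sub>m 1 l :: quat mat)" "s < dim_col (0\<^sub>m 1 l :: quat mat)"
    hence i_s: "i = 0" "s < l" by auto
    have "(x * B) $$ (0, s) = (\<Sum>j<k. x $$ (0, j) * B $$ (j, s))"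
      by (rule index_mult_mat_sum[OF x B]) (use i_s in auto)
    also have "\<dots> = (\<Sum>j<k. \<xi> j * (qadjoint V * Om) $$ (j, s))"
      using i_s by (intro sum.cong refl) (simp add: x_def Bj del: index_mult_mat)
    finally show "(x * B) $$ (i, s) = 0\<^sub>m 1 l $$ (i, s)"
      using \<xi>[OF i_s(2)] i_s by simp
  qed (use x B in auto)
  hence "x = 0\<^sub>m 1 k"
    using rank x B unfolding full_row_rank_def B_def[symmetric] by auto
  hence "x $$ (0, j) = 0" using j by simp
  thus ?thesis using j by (simp add: x_def)
qed

theorem theorem1:
  fixes M :: "'w measure" and m n k p :: nat
    and A U V :: "quat mat" and \<sigma> :: "nat \<Rightarrow> real"
    and \<Omega> Q :: "'w \<Rightarrow> quat mat"
  assumes "n \<le> m" and "A \<in> carrier_mat m n"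
    and "is_qsvd m n A U \<sigma> V"
    and "1 \<le> k" and "1 \<le> p" and "k + p \<le> n"
    and "quat_random_test_matrix M n (k + p) \<Omega>"
    and "AE \<omega> in M. full_row_rank (qadjoint (first_cols k V) * \<Omega> \<omega>)"
    and "\<And>\<omega>. \<omega> \<in> space M \<Longrightarrow> is_qr_basis (A * \<Omega> \<omega>) (Q \<omega>)"
    and "(\<lambda>\<omega>. frobenius_norm (rqsvd_approx A (Q \<omega>) - A)) \<in> borel_measurable M"
  shows "integrable M (\<lambda>\<omega>. frobenius_norm (rqsvd_approx A (Q \<omega>) - A)) \<and>
    prob_space.expectation M (\<lambda>\<omega>. frobenius_norm (rqsvd_approx A (Q \<omega>) - A))
      \<le> sqrt (1 + 4 * real k / (4 * real p + 2)) * sqrt (\<Sum>j = k..<n. (\<sigma> j)\<^sup>2)"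
proof -
  define l where "l = k + p"
  let ?I = "index_set n l"
  interpret prob_space M using assms(7) by (simp add: quat_random_test_matrix_def)
  define X where "X \<omega> = frobenius_norm (rqsvd_approx A (Q \<omega>) - A)" for \<omega>
  have X [measurable]: "X \<in> borel_measurable M" unfolding X_def by (rule assms(10))
  have X0: "0 \<le> X \<omega>" for \<omega> by (simp add: X_def frobenius_norm_def sum_nonneg)
  have V: "qunitary n V" "V \<in> carrier_mat n n"
    using assms(3) by (auto simp: is_qsvd_def qunitary_def)
  have V': "qunitary n (qadjoint V)"
    using V by (auto simp: qunitary_def qadjoint_qadjoint)
  have Om: "\<Omega> \<omega> \<in> carrier_mat n l" if "\<omega> \<in> space M" for \<omega>
    using assms(7) that by (auto simp: quat_random_test_matrix_def l_def)
  \<comment> \<open>With \<open>x\<close> the coordinates of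
    \<open>qadjoint V * \<Omega> \<omega>\<close>, \<open>F j i x\<close> is the squared modulus of
    entry \<open>(j, i)\<close> of that matrix times the right inverse, and \<open>h\<close> is the
    right-hand side of the deterministic bound. Both depend on the coordinates alone, so the choice
    of \<open>Q\<close> no longer enters.\<close>
  define F where "F j i x = (norm (\<Sum>s<l. entry x j s * right_inv k l i x s))\<^sup>2" for j i x
  define h where "h x = (\<Sum>j=k..<n. (\<sigma> j)\<^sup>2 * (1 + (\<Sum>i<k. F j i x)))" for x
  have F0: "0 \<le> F j i x" for j i x by (simp add: F_def)
  have h0: "0 \<le> h x" for x unfolding h_def by (intro sum_nonneg mult_nonneg_nonneg add_nonneg_nonneg F0) auto
  have F_meas: "F j i \<in> borel_measurable (gauss ?I)" if "i < k" "j < n" for i j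
    unfolding F_def[abs_def]
    using that assms(6) by (intro quat_measurable_norm_sq quat_measurable_sum quat_measurable_mult
        quat_measurable_entry quat_measurable_right_inv) auto
  have h_meas: "h \<in> borel_measurable (gauss ?I)"
    unfolding h_def[abs_def]
    by (intro borel_measurable_sum borel_measurable_times borel_measurable_add borel_measurable_const F_meas) auto
  define G where "G \<omega> = qadjoint V * \<Omega> \<omega>" for \<omega>
  have G: "G \<omega> \<in> carrier_mat n l" if "\<omega> \<in> space M" for \<omega>
    unfolding G_def by (rule mult_carrier_mat[OF qadjoint_carrier[OF V(2)] Om[OF that]])
  have bound: "AE \<omega> in M. (X \<omega>)\<^sup>2 \<le> h (coords n l (G \<omega>))"
    using assms(8) AE_space
  proof eventually_elim
    case (elim \<omega>)
    note \<omega> = elim(2)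
    define x where "x = coords n l (G \<omega>)"
    define R where "R = mat l k (\<lambda>(s, i). right_inv k l i x s)"
    have R: "R \<in> carrier_mat l k" by (simp add: R_def)
    have GR: "(G \<omega> * R) $$ (j, i) = (\<Sum>s<l. entry x j s * right_inv k l i x s)"
      if "j < n" "i < k" for j i
      unfolding index_mult_mat_sum[OF G[OF \<omega>] R that] using that
      by (intro sum.cong refl) (simp add: R_def x_def entry_coords)
    \<comment> \<open>Full row rank is left independence of the first \<open>k\<close> rows, which
      keeps every residual nonzero and makes \<open>R\<close> a right inverse.\<close>
    have nz: "resid_sq k l i x \<noteq> 0" if "i < k" for i
    proof (rule resid_sq_nonzero[OF that])
      fix \<xi> assume "\<forall>s<l. (\<Sum>j<k. \<xi> j * entry x j s) = 0"
      hence "(\<Sum>j<k. \<xi> j * (qadjoint V * \<Omega> \<omega>) $$ (j, s)) = 0" if "s < l" for s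
        using that assms(6) by (simp add: x_def entry_coords G_def del: index_mult_mat)
      from full_row_rank_left_cancel[OF V(2) Om[OF \<omega>] _ elim(1) this] assms(6)
      show "\<forall>j<k. \<xi> j = 0" by simp
    qed
    have "(X \<omega>)\<^sup>2 \<le> (\<Sum>j=k..<n. (\<sigma> j)\<^sup>2 * (1 + (\<Sum>i<k. (norm ((G \<omega> * R) $$ (j, i)))\<^sup>2)))"
      unfolding X_def G_def
    proof (rule rqsvd_error_sq_le[OF assms(1-3) _ Om[OF \<omega>] assms(9)[OF \<omega>] R])
      fix i j assume "i < k" "j < k"
      thus "(qadjoint V * \<Omega> \<omega> * R) $$ (i, j) = of_bool (i = j)"
        unfolding G_def[symmetric] using assms(6) by (simp add: GR right_inv_mult nz del: index_mult_mat)
    qed (use assms(6) in simp)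
    also have "\<dots> = h x"
      unfolding h_def F_def by (intro sum.cong refl arg_cong2[of _ _ _ _ "(*)"] arg_cong2[of _ _ _ _ "(+)"])
        (simp add: GR del: index_mult_mat)
    finally show ?case by (simp add: x_def)
  qed
  define B where "B = (1 + 4 * real k / (4 * real p + 2)) * (\<Sum>j=k..<n. (\<sigma> j)\<^sup>2)"
  have np: "0 < n" "0 < l" using assms(4-6) by (auto simp: l_def)
  have "(\<integral>\<^sup>+\<omega>. ennreal ((X \<omega>)\<^sup>2) \<partial>M) \<le> (\<integral>\<^sup>+\<omega>. ennreal (h (coords n l (G \<omega>))) \<partial>M)"
    using bound by (intro nn_integral_mono_AE) (auto elim!: eventually_mono intro!: ennreal_leI)
  \<comment> \<open>The integrand is now a function of the coordinates of the test matrix, whose law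
    is \<open>gauss\<close>; unitary invariance then removes \<open>qadjoint V\<close>.\<close>
  also have "\<dots> = (\<integral>\<^sup>+\<omega>. ennreal (h (coords n l (qadjoint V * of_coords n l (coords n l (\<Omega> \<omega>))))) \<partial>M)"
    by (intro nn_integral_cong) (simp add: G_def of_coords_coords Om)
  also have "\<dots> = (\<integral>\<^sup>+x. ennreal (h (coords n l (qadjoint V * of_coords n l x)))
      \<partial>distr M (gauss ?I) (\<lambda>\<omega>. coords n l (\<Omega> \<omega>)))"
    using distr_coords_random_test_matrix(1)[OF assms(7)[folded l_def] np]
      measurable_compose[OF measurable_coords_mult[OF qadjoint_carrier[OF V(2)]] h_meas]
    by (intro nn_integral_distr[symmetric]) auto
  also have "\<dots> = (\<integral>\<^sup>+x. ennreal (h (coords n l (qadjoint V * of_coords n l x))) \<partial>gauss ?I)"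
    by (simp only: distr_coords_random_test_matrix(2)[OF assms(7)[folded l_def] np])
  also have "\<dots> = (\<integral>\<^sup>+x. ennreal (h x) \<partial>gauss ?I)"
    by (rule nn_integral_gauss_unitary[OF V']) (use h_meas in measurable)
  also have "\<dots> = (\<integral>\<^sup>+x. (\<Sum>j=k..<n. ennreal ((\<sigma> j)\<^sup>2) * (1 + (\<Sum>i<k. ennreal (F j i x)))) \<partial>gauss ?I)"
  proof (rule nn_integral_cong)
    fix x
    have "ennreal ((\<sigma> j)\<^sup>2 * (1 + (\<Sum>i<k. F j i x))) = ennreal ((\<sigma> j)\<^sup>2) * (1 + (\<Sum>i<k. ennreal (F j i x)))" for j
      by (simp add: ennreal_mult' ennreal_plus sum_ennreal sum_nonneg F0)
    thus "ennreal (h x) = (\<Sum>j=k..<n. ennreal ((\<sigma> j)\<^sup>2) * (1 + (\<Sum>i<k. ennreal (F j i x))))"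
      unfolding h_def
      by (subst sum_ennreal[symmetric]) (auto intro!: mult_nonneg_nonneg add_nonneg_nonneg sum_nonneg F0)
  qed
  also have "\<dots> = (\<Sum>j=k..<n. ennreal ((\<sigma> j)\<^sup>2) * (1 + (\<Sum>i<k. \<integral>\<^sup>+x. ennreal (F j i x) \<partial>gauss ?I)))"
  proof -
    interpret I: prob_space "gauss ?I" by (rule prob_space_gauss)
    have [measurable]: "F j i \<in> borel_measurable (gauss ?I)" if "j \<in> {k..<n}" "i \<in> {..<k}" for i j
      using F_meas that by auto
    show ?thesis
      using I.emeasure_space_1
      by (simp add: nn_integral_sum nn_integral_cmult nn_integral_add del: space_gauss)
  qed
  \<comment> \<open>For every \<open>j\<close> each of the \<open>k\<close> columns contributes at
    most \<open>4 / (4 * real p + 2)\<close>, whence the factor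
    \<open>1 + 4 k / (4 p + 2)\<close>.\<close>
  also have "\<dots> \<le> (\<Sum>j=k..<n. ennreal ((\<sigma> j)\<^sup>2) * (1 + (\<Sum>i<k. ennreal (4 / (4 * real p + 2)))))"
    unfolding F_def l_def using assms(5)
    by (intro sum_mono mult_left_mono add_left_mono nn_integral_norm_mult_right_inv) auto
  also have "\<dots> = (\<Sum>j=k..<n. ennreal ((\<sigma> j)\<^sup>2 * (1 + 4 * real k / (4 * real p + 2))))"
  proof -
    have "1 + (\<Sum>i<k. ennreal (4 / (4 * real p + 2))) = ennreal (1 + (\<Sum>i<k. 4 / (4 * real p + 2)))"
    proof -
      have "1 + (\<Sum>i<k. ennreal (4 / (4 * real p + 2))) = ennreal 1 + ennreal (\<Sum>i<k. 4 / (4 * real p + 2))"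
        by (subst sum_ennreal) auto
      also have "\<dots> = ennreal (1 + (\<Sum>i<k. 4 / (4 * real p + 2)))"
        by (intro ennreal_plus[symmetric] sum_nonneg) auto
      finally show ?thesis .
    qed
    thus ?thesis by (simp add: ennreal_mult' mult.commute)
  qed
  also have "\<dots> = ennreal B"
    unfolding B_def sum_distrib_left
    by (subst sum_ennreal) (simp_all add: mult.commute)
  finally have nn: "(\<integral>\<^sup>+\<omega>. ennreal ((X \<omega>)\<^sup>2) \<partial>M) \<le> ennreal B" .
  have B0: "0 \<le> B" unfolding B_def by (intro mult_nonneg_nonneg sum_nonneg) auto
  \<comment> \<open>A finite second moment on a probability space also gives integrability of
    \<open>X\<close> itself.\<close>
  have X2: "integrable M (\<lambda>\<omega>. (X \<omega>)\<^sup>2)"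
    using nn by (intro integrableI_bounded) (auto simp: ennreal_less_top intro: le_less_trans)
  hence X1: "integrable M X"
    by (rule square_integrable_imp_integrable[OF X])
  \<comment> \<open>Jensen's inequality for the square, in the form that the variance is
    nonnegative.\<close>
  have "(expectation X)\<^sup>2 \<le> expectation (\<lambda>\<omega>. (X \<omega>)\<^sup>2)"
    using variance_positive[of X] variance_eq[OF X1 X2] by simp
  also have "\<dots> \<le> B"
    using nn nn_integral_eq_integral[OF X2] B0 by simp
  finally have "expectation X \<le> sqrt B"
    by (rule real_le_rsqrt)
  thus ?thesis
    using X1 unfolding X_def[abs_def] B_def real_sqrt_mult by simp
qed

end
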